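(* Let $\psi\colon(1,\infty)\to(0,\infty)$ be an unbounded strictly increasing function, let $\mathbf{x}_0$ be a non-zero point of $\mathbb{Z}^3$ and let $\delta>0$. Then there exist linearly independent unit vectors $\mathbf{u},\mathbf{v},\mathbf{w}\in\mathbb{R}^3$ and positive constants $C,C'$ with the following properties. (i) The coordinates of $\mathbf{u}$ are linearly independent over $\mathbb{Q}$. (ii) $\mathbf{u}\cdot\mathbf{v}=\mathbf{u}\cdot\mathbf{w}=0$, $\mathrm{dist}(\mathbf{x}_0,\mathbf{v})\le\delta$ and $\mathrm{dist}(\mathbf{x}_0,\mathbf{w})\le\delta$. (iii) For each $X\ge 1$ there exists a non-zero $\mathbf{x}\in\mathbb{Z}^3$ such that \[ \|\mathbf{x}\|\le X,\quad |\mathbf{x}\cdot\mathbf{u}|\le \frac{C}{X^{\gamma+1}},\quad \min\{|\mathbf{x}\cdot\mathbf{v}^\perp|,|\mathbf{x}\cdot\mathbf{w}^\perp|\}\le \frac{C}{X^{\gamma+1}}, \] where $\mathbf{v}^\perp=\mathbf{u}\wedge\mathbf{v}$ and $\mathbf{w}^\perp=\mathbf{u}\wedge\mathbf{w}$. (iv) For each $\mathbf{x}\in\mathbb{Z}^3$ with $\|\mathbf{x}\|\ge C'$, \[ |\mathbf{x}\cdot\mathbf{u}|\ge \frac{\mathrm{dist}(\mathbf{x},\{\mathbf{v},\mathbf{w}\})}{\psi(\|\mathbf{x}\|)\,\|\mathbf{x}\|^{\gamma}}. \]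
   Context: $\gamma=(1+\sqrt5)/2$ is the golden ratio. For $\mathbf{x},\mathbf{y}\in\mathbb{R}^3$, $\mathbf{x}\cdot\mathbf{y}$ is the scalar product, $\mathbf{x}\wedge\mathbf{y}$ the cross product, $\|\mathbf{x}\|$ the Euclidean norm. For non-zero $\mathbf{x},\mathbf{y}$, the projective distance is $\mathrm{dist}(\mathbf{x},\mathbf{y})=\|\mathbf{x}\wedge\mathbf{y}\|/(\|\mathbf{x}\|\,\|\mathbf{y}\|)$ (the sine of the acute angle between the lines $\mathbb{R}\mathbf{x}$ and $\mathbb{R}\mathbf{y}$), and for a set $S$ of non-zero vectors, $\mathrm{dist}(\mathbf{x},S)=\inf_{\mathbf{y}\in S}\mathrm{dist}(\mathbf{x},\mathbf{y})$. *)

theory Defs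
  imports "HOL-Analysis.Analysis"
begin

definition golden_ratio :: real where
  "golden_ratio = (1 + sqrt 5) / 2"

definition int_points :: "(real ^ 3) set" where
  "int_points = {x. \<forall>i. x $ i \<in> \<int>}"

definition coords_lin_indep_rat :: "real ^ 3 \<Rightarrow> bool" where
  "coords_lin_indep_rat u \<longleftrightarrow>
     (\<forall>q :: 3 \<Rightarrow> rat. (\<Sum>i\<in>UNIV. of_rat (q i) * u $ i) = 0 \<longrightarrow> (\<forall>i. q i = 0))"

definition proj_dist :: "real ^ 3 \<Rightarrow> real ^ 3 \<Rightarrow> real" where
  "proj_dist x y = norm (cross3 x y) / (norm x * norm y)"

definition proj_setdist :: "real ^ 3 \<Rightarrow> (real ^ 3) set \<Rightarrow> real" where
  "proj_setdist x S = (INF y\<in>S. proj_dist x y)"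

end

theory Submission
  imports Defs
begin

text \<open>
  Write \<open>\<gamma>\<close> for the golden ratio. One builds integer points \<open>x\<^sub>0, x\<^sub>1, x\<^sub>2, \<dots>\<close> whose norms \<open>X\<^sub>n\<close> grow as fast as one
  likes, consecutive ones being part of a basis of \<open>\<int>\<^sup>3\<close>, together with unit vectors \<open>u\<^sub>n\<close> orthogonal to
  \<open>x\<^sub>n\<^sub>+\<^sub>1\<close>. The vector \<open>u\<^sub>n\<close> is such that \<open>\<bar>x\<^sub>n \<bullet> u\<^sub>n\<bar>\<close> has order \<open>X\<^sub>n\<^sub>+\<^sub>1\<close> to the power \<open>-(\<gamma> + 1)\<close> and the form
  \<open>y \<mapsto> y \<bullet> u\<^sub>n\<close> is badly approximable on the lattice \<open>\<int>\<^sup>3 / \<int> x\<^sub>n\<^sub>+\<^sub>1\<close>; the next point \<open>x\<^sub>n\<^sub>+\<^sub>2\<close> is a far convergent of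
  this form, adjusted by a multiple of \<open>x\<^sub>n\<^sub>+\<^sub>1\<close> so that its direction is close to that of \<open>x\<^sub>n\<close>. Then
  \<open>u\<close> is the limit of the \<open>u\<^sub>n\<close>, and \<open>v\<close>, \<open>w\<close> are the limit directions of the points of even and odd index.

  For an integer point \<open>y\<close> of norm \<open>Y\<close> with \<open>X\<^sub>n\<^sub>+\<^sub>1 \<le> Y powr \<gamma> < X\<^sub>n\<^sub>+\<^sub>2\<close> one may replace \<open>u\<close> by \<open>u\<^sub>n\<close> in the lower bound.
  Outside the plane of \<open>x\<^sub>n\<close> and \<open>x\<^sub>n\<^sub>+\<^sub>1\<close> either \<open>\<bar>y \<bullet> u\<^sub>n\<bar> \<ge> 1 / (2 X\<^sub>n X\<^sub>n\<^sub>+\<^sub>1)\<close>, because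
  the distance from \<open>y\<close> to a lattice plane is bounded below, or \<open>Y\<close> is at least of order \<open>X\<^sub>n\<^sub>+\<^sub>1 powr \<gamma>\<close> and bad approximability gives a bound of order
  \<open>1 / (Y X\<^sub>n\<^sub>+\<^sub>1)\<close>; since \<open>\<gamma> (\<gamma> - 1) = 1\<close> both suffice. Inside the plane the bound is an explicit
  computation. The losses are constants and factors \<open>X\<^sub>n\<close>, absorbed by \<open>\<psi>\<close> because \<open>X\<^sub>n\<^sub>+\<^sub>1\<close> is huge compared with \<open>X\<^sub>n\<close>.
\<close>

unbundle cross3_syntax

section \<open>Vector algebra in three dimensions: Cramer's rule and angle estimates by cross
  products\<close>

text \<open>Cramer's rule for the coordinates of \<open>z\<close> in \<open>p\<close>,
  \<open>q\<close>, \<open>s\<close>, multiplied by the determinant. With determinant 1 and integer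
  points it yields integer coordinates.\<close>

lemma triple_product_expansion:
  fixes p q s z :: "real ^ 3"
  shows "(p \<bullet> (q \<times> s)) *\<^sub>R z =
    (z \<bullet> (q \<times> s)) *\<^sub>R p + (p \<bullet> (z \<times> s)) *\<^sub>R q + (p \<bullet> (q \<times> z)) *\<^sub>R s"
  by (simp add: vec_eq_iff forall_3 cross_components inner_vec_def sum_3 algebra_simps)

lemma triple_product_cyclic:
  fixes p q s :: "real ^ 3"
  shows "p \<bullet> (q \<times> s) = q \<bullet> (s \<times> p)" "p \<bullet> (q \<times> s) = s \<bullet> (p \<times> q)"
  by (simp_all add: cross_components inner_vec_def sum_3 algebra_simps)

lemma norm_cross_le: "norm (x \<times> y) \<le> norm x * norm y" for x y :: "real ^ 3"
proof (rule power2_le_imp_le)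
  show "(norm (x \<times> y))\<^sup>2 \<le> (norm x * norm y)\<^sup>2"
    using norm_cross[of x y] by (simp add: power_mult_distrib)
qed simp

text \<open>For unit \<open>u\<close> and \<open>v\<close> this bounds the form
  \<open>x \<bullet> (u \<times> v)\<close> of property (iii) by the distance from \<open>x\<close>
  to the line of \<open>v\<close>.\<close>

lemma norm_triple_le: "\<bar>x \<bullet> (y \<times> z)\<bar> \<le> norm y * norm (x \<times> z)" for x y z :: "real ^ 3"
proof -
  have "x \<bullet> (y \<times> z) = - (y \<bullet> (x \<times> z))"
    by (simp add: cross_components inner_vec_def sum_3 algebra_simps)
  then show ?thesis
    using Cauchy_Schwarz_ineq2[of y "x \<times> z"] by simp
qed

lemma norm_orth_component:
  fixes a b :: "real ^ 3"
  assumes "norm b = 1"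
  shows "norm (a - (a \<bullet> b) *\<^sub>R b) = norm (a \<times> b)"
proof -
  have b: "b \<bullet> b = 1" using assms by (simp add: dot_square_norm)
  have "(norm (a - (a \<bullet> b) *\<^sub>R b))\<^sup>2 = (norm (a \<times> b))\<^sup>2"
    unfolding norm_cross assms
    unfolding power2_norm_eq_inner
    by (simp add: inner_diff_left inner_diff_right b inner_commute power2_eq_square)
  then show ?thesis by simp
qed

text \<open>The triangle inequality for the projective distance: the part of \<open>a\<close>
  orthogonal to \<open>b\<close> has norm \<open>norm (a \<times> b)\<close>, and the part along
  \<open>b\<close> contributes at most \<open>norm (b \<times> c)\<close>.\<close>

lemma norm_cross_triangle:
  fixes a b c :: "real ^ 3"
  assumes "norm a = 1" "norm b = 1" "norm c = 1"
  shows "norm (a \<times> c) \<le> norm (a \<times> b) + norm (b \<times> c)"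
proof -
  have "a \<times> c = (a - (a \<bullet> b) *\<^sub>R b) \<times> c + (a \<bullet> b) *\<^sub>R (b \<times> c)"
    by (simp add: Cross3.left_diff_distrib cross_mult_left)
  then have "norm (a \<times> c) \<le> norm ((a - (a \<bullet> b) *\<^sub>R b) \<times> c) + \<bar>a \<bullet> b\<bar> * norm (b \<times> c)"
    by (metis norm_triangle_ineq norm_scaleR)
  moreover have "norm ((a - (a \<bullet> b) *\<^sub>R b) \<times> c) \<le> norm (a \<times> b)"
    using norm_cross_le[of "a - (a \<bullet> b) *\<^sub>R b" c] norm_orth_component[OF assms(2)] assms by simp
  moreover have "\<bar>a \<bullet> b\<bar> * norm (b \<times> c) \<le> 1 * norm (b \<times> c)"
    using Cauchy_Schwarz_ineq2[of a b] assms by (intro mult_right_mono) auto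
  ultimately show ?thesis by simp
qed

text \<open>With \<open>t = a \<bullet> b\<close>, the squares of the two norms are 2 (1 - t) and (1
  - t) (1 + t). This turns closeness of lines into closeness of vectors, which is why later choices
  of sign enforce a nonnegative inner product.\<close>

lemma norm_diff_le_norm_cross:
  fixes a b :: "real ^ 3"
  assumes "norm a = 1" "norm b = 1" "a \<bullet> b \<ge> 0"
  shows "norm (a - b) \<le> 2 * norm (a \<times> b)"
proof (rule power2_le_imp_le)
  let ?t = "a \<bullet> b"
  have t: "?t \<le> 1" using Cauchy_Schwarz_ineq2[of a b] assms by simp
  have aa: "a \<bullet> a = 1" "b \<bullet> b = 1" using assms by (simp_all add: dot_square_norm)
  have "(norm (a - b))\<^sup>2 = 2 * (1 - ?t)"
    by (simp add: power2_norm_eq_inner inner_diff_left inner_diff_right aa inner_commute)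
  also have "\<dots> \<le> 4 * ((1 - ?t) * (1 + ?t))"
    using t assms(3) mult_left_mono[of 1 "1 + ?t" "1 - ?t"] by simp
  also have "\<dots> = 4 * (1 - ?t\<^sup>2)" by (simp add: power2_eq_square algebra_simps)
  finally show "(norm (a - b))\<^sup>2 \<le> (2 * norm (a \<times> b))\<^sup>2"
    using norm_cross[of a b] assms by (simp add: power_mult_distrib)
qed simp

lemma norm_cross_unit_diff:
  fixes a b c :: "real ^ 3"
  assumes "norm c = 1"
  shows "norm (a \<times> c) \<le> norm (b \<times> c) + norm (a - b)"
    and "norm (c \<times> a) \<le> norm (c \<times> b) + norm (a - b)"
proof -
  have "a \<times> c = b \<times> c + (a - b) \<times> c" by (simp add: Cross3.left_diff_distrib)
  then show "norm (a \<times> c) \<le> norm (b \<times> c) + norm (a - b)"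
    using norm_triangle_ineq[of "b \<times> c" "(a - b) \<times> c"] norm_cross_le[of "a - b" c] assms by simp
  then show "norm (c \<times> a) \<le> norm (c \<times> b) + norm (a - b)"
    using cross_skew[of a c] cross_skew[of b c] by simp
qed

lemma norm_le_component_plus_cross:
  fixes V y :: "real ^ 3"
  assumes "y \<noteq> 0"
  shows "norm V \<le> \<bar>V \<bullet> y\<bar> / norm y + norm (V \<times> y) / norm y"
proof -
  have "(norm V * norm y)\<^sup>2 \<le> (\<bar>V \<bullet> y\<bar> + norm (V \<times> y))\<^sup>2"
    using norm_cross_dot[of V y, symmetric] by (simp add: power2_sum)
  then have "norm V * norm y \<le> \<bar>V \<bullet> y\<bar> + norm (V \<times> y)"
    by (rule power2_le_imp_le) simp
  then show ?thesis using assms by (simp add: field_simps)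
qed

section \<open>Integer points and bases of the integer lattice\<close>

lemma int_points_add: "x \<in> int_points \<Longrightarrow> y \<in> int_points \<Longrightarrow> x + y \<in> int_points"
  and int_points_diff: "x \<in> int_points \<Longrightarrow> y \<in> int_points \<Longrightarrow> x - y \<in> int_points"
  and int_points_uminus: "x \<in> int_points \<Longrightarrow> - x \<in> int_points"
  and int_points_scaleR: "c \<in> \<int> \<Longrightarrow> x \<in> int_points \<Longrightarrow> c *\<^sub>R x \<in> int_points"
  and int_points_cross: "x \<in> int_points \<Longrightarrow> y \<in> int_points \<Longrightarrow> x \<times> y \<in> int_points"
  and int_points_inner: "x \<in> int_points \<Longrightarrow> y \<in> int_points \<Longrightarrow> x \<bullet> y \<in> \<int>"
  by (auto simp: int_points_def forall_3 cross_components inner_vec_def sum_3)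

lemmas int_points_intros = int_points_add int_points_diff int_points_uminus int_points_scaleR
  int_points_cross int_points_inner Ints_of_int

lemma norm_int_point_ge_1:
  assumes "x \<in> int_points" "x \<noteq> 0"
  shows "norm x \<ge> 1"
proof -
  obtain i where "x $ i \<noteq> 0" using assms(2) by (auto simp: vec_eq_iff)
  moreover have "x $ i \<in> \<int>" using assms(1) by (simp add: int_points_def)
  ultimately have "\<bar>x $ i\<bar> \<ge> 1" using Ints_nonzero_abs_ge1 by blast
  then show ?thesis using component_le_norm_cart[of x i] by linarith
qed

text \<open>Bezout is used twice: for the first two coordinates, then for their common factor and
  the third. The coefficients become entries of \<open>b\<close> and \<open>c\<close>, and the
  determinant is the product of the two Bezout identities.\<close>

lemma int_point_primitive_completion:
  assumes x: "x \<in> int_points" "x \<noteq> 0"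
  obtains d p b c where "d > 0" "x = d *\<^sub>R p" "p \<in> int_points" "b \<in> int_points" "c \<in> int_points"
    "p \<bullet> (b \<times> c) = 1"
proof -
  have split: "\<exists>g a' b' s t. a = g * a' \<and> b = g * b' \<and> s * a' + t * b' = 1" for a b :: int
  proof (cases "gcd a b = 0")
    case True
    then show ?thesis by (intro exI[of _ 0] exI[of _ 1] exI[of _ 0]) auto
  next
    case False
    obtain s t where st: "s * a + t * b = gcd a b" using bezout_int by blast
    obtain a' b' where ab: "a = gcd a b * a'" "b = gcd a b * b'" by (meson dvd_def gcd_dvd1 gcd_dvd2)
    have "gcd a b * (s * a' + t * b') = gcd a b * 1"
      using st ab by (metis distrib_left mult.left_commute mult.right_neutral)
    then have "s * a' + t * b' = 1" using False mult_left_cancel by blast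
    then show ?thesis using ab by blast
  qed
  have "x $ 1 \<in> \<int>" "x $ 2 \<in> \<int>" "x $ 3 \<in> \<int>" using x(1) by (auto simp: int_points_def)
  then obtain x1 x2 x3 where X: "x $ 1 = of_int x1" "x $ 2 = of_int x2" "x $ 3 = of_int x3"
    by (auto elim!: Ints_cases)
  obtain g a1 a2 s t where 1: "x1 = g * a1" "x2 = g * a2" "s * a1 + t * a2 = 1" using split by blast
  obtain d g' a3 z c3 where 2: "g = d * g'" "x3 = d * a3" "c3 * g' + z * a3 = 1" using split by metis
  define p :: "real ^ 3" where "p = vector [of_int (g' * a1), of_int (g' * a2), of_int a3]"
  define b :: "real ^ 3" where "b = vector [of_int (- t), of_int s, 0]"
  define c :: "real ^ 3" where "c = vector [of_int (- z * a1), of_int (- z * a2), of_int c3]"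
  have pbc: "p \<bullet> (b \<times> c) = 1"
  proof -
    have "p \<bullet> (b \<times> c) = of_int (c3 * g' * (s * a1 + t * a2) + z * a3 * (s * a1 + t * a2))"
      by (simp add: p_def b_def c_def cross_components inner_vec_def sum_3 algebra_simps)
    also have "\<dots> = 1" using 1(3) 2(3) by simp
    finally show ?thesis .
  qed
  have xd: "x = of_int d *\<^sub>R p"
    using X 1 2 by (simp add: vec_eq_iff forall_3 p_def algebra_simps)
  have ints: "p \<in> int_points" "b \<in> int_points" "c \<in> int_points"
    by (simp_all add: int_points_def forall_3 p_def b_def c_def)
  have "d \<noteq> 0" using xd x(2) by auto
  show thesis
  proof (cases "d > 0")
    case True
    then show thesis using that[of "of_int d" p b c] xd ints pbc by auto
  next
    \<comment> \<open>Negating both \<open>p\<close> and \<open>b\<close> makes the factor positive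
      and keeps the determinant.\<close>
    case False
    then show thesis
      using that[of "- of_int d" "- p" "- b" c] xd ints pbc \<open>d \<noteq> 0\<close> by (auto intro: int_points_uminus)
  qed
qed

text \<open>The coordinates in the basis \<open>p\<close>, \<open>q\<close>, \<open>r\<close> are
  integer determinants, and the one along \<open>r\<close> is
  \<open>x \<bullet> (p \<times> q) = 0\<close>.\<close>

lemma int_point_in_plane:
  assumes "p \<in> int_points" "q \<in> int_points" "r \<in> int_points" "p \<bullet> (q \<times> r) = 1"
    and "x \<in> int_points" "x \<bullet> (p \<times> q) = 0"
  obtains a b :: int where "x = of_int a *\<^sub>R p + of_int b *\<^sub>R q"
proof -
  have "p \<bullet> (q \<times> x) = 0" using assms(6) triple_product_cyclic(2)[of p q x] by simp
  then have "x = (x \<bullet> (q \<times> r)) *\<^sub>R p + (p \<bullet> (x \<times> r)) *\<^sub>R q"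
    using triple_product_expansion[of p q r x] assms(4) by simp
  moreover have "x \<bullet> (q \<times> r) \<in> \<int>" "p \<bullet> (x \<times> r) \<in> \<int>" using assms by (auto intro: int_points_intros)
  ultimately show thesis using that by (metis Ints_cases)
qed

section \<open>Bad approximability of the square root of 2, and facts on the golden ratio\<close>

text \<open>The product of the form with its conjugate is a nonzero integer. If the form were too
  small, the conjugate would be at most \<open>4 * \<bar>m\<bar>\<close> and the product below
  1.\<close>

lemma sqrt2_form_lower_bound:
  fixes m n :: int
  assumes "m \<noteq> 0"
  shows "\<bar>of_int m * sqrt 2 + of_int n\<bar> \<ge> 1 / (4 * \<bar>of_int m\<bar>)"
proof (rule ccontr)
  let ?f = "of_int m * sqrt 2 + of_int n" and ?g = "of_int m * sqrt 2 - of_int n"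
  assume "\<not> ?thesis"
  then have small: "\<bar>?f\<bar> < 1 / (4 * \<bar>of_int m\<bar>)" by simp
  have m1: "\<bar>real_of_int m\<bar> \<ge> 1" using assms by linarith
  \<comment> \<open>The multiplicity of 2 is odd on the left and even on the right.\<close>
  have "2 * m\<^sup>2 \<noteq> n\<^sup>2"
  proof
    assume "2 * m\<^sup>2 = n\<^sup>2"
    moreover from this have "n \<noteq> 0" using assms by auto
    moreover have "multiplicity 2 (2 * m\<^sup>2) = Suc (2 * multiplicity 2 m)"
      using assms by (subst prime_elem_multiplicity_mult_distrib)
        (auto simp: prime_elem_multiplicity_power_distrib)
    moreover have "multiplicity 2 (n\<^sup>2) = 2 * multiplicity 2 n"
      using \<open>n \<noteq> 0\<close> by (simp add: prime_elem_multiplicity_power_distrib)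
    ultimately show False by presburger
  qed
  then have "\<bar>2 * m\<^sup>2 - n\<^sup>2\<bar> \<ge> 1" by linarith
  then have "\<bar>real_of_int (2 * m\<^sup>2 - n\<^sup>2)\<bar> \<ge> 1" by linarith
  moreover have "real_of_int (2 * m\<^sup>2 - n\<^sup>2) = ?f * ?g"
    by (simp add: algebra_simps power2_eq_square)
  ultimately have ge: "1 \<le> \<bar>?f\<bar> * \<bar>?g\<bar>" by (simp add: abs_mult)
  have "1 / (4 * \<bar>real_of_int m\<bar>) \<le> 1 / 4" using m1 by (simp add: field_simps)
  then have f1: "\<bar>?f\<bar> < 1 / 4" using small by linarith
  have "sqrt 2 < 3/2" by (rule real_less_lsqrt) (simp_all add: power2_eq_square)
  then have "\<bar>of_int m * sqrt 2\<bar> \<le> \<bar>real_of_int m\<bar> * (3/2)"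
    unfolding abs_mult by (intro mult_left_mono) auto
  then have "\<bar>?g\<bar> \<le> 4 * \<bar>real_of_int m\<bar>" using f1 m1 by linarith
  then have "\<bar>?f\<bar> * \<bar>?g\<bar> \<le> \<bar>?f\<bar> * (4 * \<bar>real_of_int m\<bar>)" by (intro mult_left_mono) auto
  also have "\<dots> < 1" using small m1 by (simp add: field_simps)
  finally show False using ge by simp
qed

lemma golden_ratio_bounds: "3 / 2 < golden_ratio" "golden_ratio < 2"
proof -
  have "2 < sqrt 5" by (rule real_less_rsqrt) simp
  moreover have "sqrt 5 < 3" by (rule real_less_lsqrt) auto
  ultimately show "3 / 2 < golden_ratio" "golden_ratio < 2" by (simp_all add: golden_ratio_def)
qed

lemma golden_ratio_square: "golden_ratio * golden_ratio = golden_ratio + 1"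
  by (simp add: golden_ratio_def field_simps)

lemma square_le_powr_golden:
  assumes "Q \<ge> 1"
  shows "Q\<^sup>2 \<le> Q powr (golden_ratio + 1)"
proof -
  have "Q\<^sup>2 = Q powr 2" using assms by (simp add: powr_numeral)
  also have "\<dots> \<le> Q powr (golden_ratio + 1)"
    using assms golden_ratio_bounds by (intro powr_mono) auto
  finally show ?thesis .
qed

section \<open>A single stage: lower bounds for the form given by \<open>u\<close>\<close>

text \<open>
  On the plane lattice \<open>\<int>\<^sup>3 / \<int> q\<close> the vector \<open>u\<close> is the linear form with slope
  \<open>\<theta> = N + sqrt 2\<close>, which is badly approximable with constants not depending on \<open>N\<close>.  The integer
  \<open>N\<close> serves to tune \<open>\<bar>p \<bullet> u\<bar> = 1 / T\<close>.
\<close>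

definition stage :: "real ^ 3 \<Rightarrow> real ^ 3 \<Rightarrow> real ^ 3 \<Rightarrow> real \<Rightarrow> real ^ 3 \<Rightarrow> int \<Rightarrow> bool" where
  "stage p q u T r N \<longleftrightarrow>
     p \<in> int_points \<and> q \<in> int_points \<and> r \<in> int_points \<and> p \<bullet> (q \<times> r) = 1 \<and> norm u = 1 \<and>
     norm q powr (golden_ratio + 1) \<le> T \<and> T \<le> 4 * norm q powr (golden_ratio + 1) \<and>
     (T *\<^sub>R u = q \<times> (r - (of_int N + sqrt 2) *\<^sub>R p) \<or>
      T *\<^sub>R u = - (q \<times> (r - (of_int N + sqrt 2) *\<^sub>R p)))"

text \<open>If \<open>x\<close> has coordinates \<open>a\<close>, \<open>b\<close>, \<open>c\<close>
  in the basis \<open>p\<close>, \<open>q\<close>, \<open>r\<close>, then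
  \<open>T * (x \<bullet> u)\<close> is \<open>a + \<theta> * c\<close> up to sign, with
  \<open>\<theta> = N + sqrt 2\<close>. The identity for \<open>(p \<times> q) \<times> u\<close>
  says that \<open>u\<close> is almost normal to the plane of \<open>p\<close> and
  \<open>q\<close>.\<close>

lemma stage_basics:
  assumes "stage p q u T r N"
  shows "p \<noteq> 0" "q \<noteq> 0" "norm p \<ge> 1" "norm q \<ge> 1" "T \<ge> (norm q)\<^sup>2" "T \<ge> 1" "u \<bullet> q = 0"
    "\<bar>x \<bullet> u\<bar> * T = \<bar>x \<bullet> (q \<times> r) + (of_int N + sqrt 2) * (x \<bullet> (p \<times> q))\<bar>"
    "\<bar>p \<bullet> u\<bar> = 1 / T" "norm ((p \<times> q) \<times> u) = norm q / T" "norm (p \<times> q) \<ge> 1"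
proof -
  let ?\<theta> = "of_int N + sqrt 2"
  note st = assms[unfolded stage_def]
  show p0: "p \<noteq> 0" and q0: "q \<noteq> 0" using st by auto
  show "norm p \<ge> 1" and q1: "norm q \<ge> 1" using norm_int_point_ge_1 p0 q0 st by auto
  have "1\<^sup>2 \<le> (norm q)\<^sup>2" using q1 by (intro power_mono) auto
  then show "T \<ge> (norm q)\<^sup>2" and T1: "T \<ge> 1"
    using st square_le_powr_golden[OF q1] by auto
  have form: "T * \<bar>x \<bullet> u\<bar> = \<bar>x \<bullet> (q \<times> (r - ?\<theta> *\<^sub>R p))\<bar>" for x
  proof -
    have "T * \<bar>x \<bullet> u\<bar> = \<bar>x \<bullet> (T *\<^sub>R u)\<bar>" using T1 by (simp add: abs_mult)
    also have "\<dots> = \<bar>x \<bullet> (q \<times> (r - ?\<theta> *\<^sub>R p))\<bar>"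
      using st by (elim conjE disjE) (simp_all del: inner_scaleR_right)
    finally show ?thesis .
  qed
  have lin: "x \<bullet> (q \<times> (r - ?\<theta> *\<^sub>R p)) = x \<bullet> (q \<times> r) + ?\<theta> * (x \<bullet> (p \<times> q))" for x
    by (simp add: cross_components inner_vec_def sum_3 algebra_simps)
  show "\<bar>x \<bullet> u\<bar> * T = \<bar>x \<bullet> (q \<times> r) + ?\<theta> * (x \<bullet> (p \<times> q))\<bar>"
    using form[of x] lin[of x] by (simp add: mult.commute)
  have "T * \<bar>q \<bullet> u\<bar> = 0" using form[of q] by (simp add: dot_cross_self)
  then show "u \<bullet> q = 0" using T1 by (simp add: inner_commute)
  have "T * \<bar>p \<bullet> u\<bar> = 1" using form[of p] lin[of p] st by (simp add: dot_cross_self)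
  then show "\<bar>p \<bullet> u\<bar> = 1 / T" using T1 by (simp add: field_simps)
  have "(p \<times> q) \<times> (q \<times> (r - ?\<theta> *\<^sub>R p)) = (p \<bullet> (q \<times> r)) *\<^sub>R q"
    by (simp add: vec_eq_iff forall_3 cross_components inner_vec_def sum_3 algebra_simps)
  then have *: "(p \<times> q) \<times> (q \<times> (r - ?\<theta> *\<^sub>R p)) = q" using st by simp
  have "T * norm ((p \<times> q) \<times> u) = norm ((p \<times> q) \<times> (T *\<^sub>R u))"
    using T1 by (simp add: cross_mult_right)
  also have "\<dots> = norm q" using st * by auto
  finally show "norm ((p \<times> q) \<times> u) = norm q / T" using T1 by (simp add: field_simps)
  have "r \<bullet> (p \<times> q) = 1" using triple_product_cyclic(2)[of p q r] st by simp
  then have "p \<times> q \<noteq> 0" by auto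
  then show "norm (p \<times> q) \<ge> 1" using st by (intro norm_int_point_ge_1 int_points_cross) auto
qed

text \<open>The nonzero integer \<open>x \<bullet> (p \<times> q)\<close> is split along
  \<open>u\<close>. Unless the first alternative holds, the part along \<open>u\<close> is below
  1/2, so the other part, at most \<open>norm x * norm q / T\<close>, carries at least half of the
  integer. Then \<open>norm x\<close> is large and the bound for \<open>sqrt 2\<close>
  applies.\<close>

lemma stage_off_plane:
  assumes st: "stage p q u T r N" and x: "x \<in> int_points" and m: "x \<bullet> (p \<times> q) \<noteq> 0"
  shows "\<bar>x \<bullet> u\<bar> \<ge> 1 / (2 * norm p * norm q) \<or>
    \<bar>x \<bullet> u\<bar> \<ge> 1 / (8 * norm x * norm q) \<and> norm x \<ge> T / (2 * norm q)"
proof (cases "\<bar>x \<bullet> u\<bar> \<ge> 1 / (2 * norm p * norm q)")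
  case False
  let ?y = "p \<times> q" and ?\<theta> = "of_int N + sqrt 2"
  note S = stage_basics[OF st]
  have P: "norm p > 0" and Q: "norm q > 0" and T: "T > 0" using S(3,4,6) by linarith+
  have ints: "p \<in> int_points" "q \<in> int_points" "r \<in> int_points" using st by (auto simp: stage_def)
  have u1: "norm u = 1" using st by (simp add: stage_def)
  obtain mm where mm: "x \<bullet> ?y = of_int mm" using ints x by (meson Ints_cases int_points_cross int_points_inner)
  obtain n where n: "x \<bullet> (q \<times> r) = of_int n" using ints x by (meson Ints_cases int_points_cross int_points_inner)
  have m0: "mm \<noteq> 0" using m mm by auto
  then have m1: "\<bar>real_of_int mm\<bar> \<ge> 1" by linarith
  have small: "norm p * norm q * \<bar>x \<bullet> u\<bar> < 1 / 2" using False P Q by (simp add: field_simps)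
  have "x \<bullet> ?y = x \<bullet> (?y - (?y \<bullet> u) *\<^sub>R u) + (?y \<bullet> u) * (x \<bullet> u)"
    by (simp add: inner_diff_right)
  then have "\<bar>x \<bullet> ?y\<bar> \<le> \<bar>x \<bullet> (?y - (?y \<bullet> u) *\<^sub>R u)\<bar> + \<bar>?y \<bullet> u\<bar> * \<bar>x \<bullet> u\<bar>"
    by (metis abs_mult abs_triangle_ineq)
  also have "\<bar>x \<bullet> (?y - (?y \<bullet> u) *\<^sub>R u)\<bar> \<le> norm x * (norm q / T)"
    using Cauchy_Schwarz_ineq2[of x "?y - (?y \<bullet> u) *\<^sub>R u"] norm_orth_component[OF u1, of ?y] S(10) by simp
  also have "\<bar>?y \<bullet> u\<bar> * \<bar>x \<bullet> u\<bar> \<le> (norm p * norm q) * \<bar>x \<bullet> u\<bar>"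
    using Cauchy_Schwarz_ineq2[of ?y u] norm_cross_le[of p q] u1 by (intro mult_right_mono) auto
  finally have "\<bar>real_of_int mm\<bar> \<le> norm x * (norm q / T) + norm p * norm q * \<bar>x \<bullet> u\<bar>" using mm by simp
  then have mle: "\<bar>real_of_int mm\<bar> / 2 \<le> norm x * norm q / T"
    using small m1 unfolding times_divide_eq_right by linarith
  then have "1 / 2 \<le> norm x * norm q / T" using m1 by linarith
  then have X: "norm x \<ge> T / (2 * norm q)" using T Q by (simp add: field_simps)
  have X0: "norm x > 0" using X T Q by (smt (verit) divide_pos_pos mult_pos_pos)
  have "\<bar>x \<bullet> u\<bar> * T = \<bar>of_int mm * sqrt 2 + of_int (n + N * mm)\<bar>"
    using S(8)[of x] mm n by (simp add: algebra_simps)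
  then have "\<bar>x \<bullet> u\<bar> * T \<ge> 1 / (4 * \<bar>real_of_int mm\<bar>)"
    using sqrt2_form_lower_bound[OF m0, of "n + N * mm"] by simp
  moreover have "1 / (4 * \<bar>real_of_int mm\<bar>) \<ge> 1 / (4 * (2 * (norm x * norm q / T)))"
    using mle m0 X0 Q T by (intro divide_left_mono mult_pos_pos divide_pos_pos) auto
  moreover have "1 / (4 * (2 * (norm x * norm q / T))) = T / (8 * norm x * norm q)" by simp
  ultimately have "\<bar>x \<bullet> u\<bar> * T \<ge> T / (8 * norm x * norm q)" by linarith
  then have "\<bar>x \<bullet> u\<bar> \<ge> 1 / (8 * norm x * norm q)" using T X0 Q by (simp add: field_simps)
  then show ?thesis using X by blast
qed simp

lemma stage_in_plane:
  assumes st: "stage p q u T r N"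
  shows "\<bar>(of_int a *\<^sub>R p + of_int b *\<^sub>R q) \<bullet> u\<bar> = \<bar>of_int a\<bar> / T"
  using stage_basics(7,9)[OF st] by (simp add: inner_add_left inner_commute[of q u] abs_mult)

text \<open>A cruder bound valid on and off the plane, used to show that passing from
  \<open>u\<close> to the limit loses at most a factor 2. Multiples of \<open>q\<close> are excluded
  because the form vanishes on them.\<close>

lemma stage_lower_bound:
  assumes st: "stage p q u T r N" and x: "x \<in> int_points" and nz: "\<And>b::int. x \<noteq> of_int b *\<^sub>R q"
  shows "\<bar>x \<bullet> u\<bar> \<ge> 1 / (8 * norm p * T * norm x)"
proof -
  note S = stage_basics[OF st]
  have P: "norm p \<ge> 1" and Q: "norm q \<ge> 1" and T: "T \<ge> 1" using S by auto
  have x0: "x \<noteq> 0" using nz[of 0] by auto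
  then have X: "norm x \<ge> 1" using x norm_int_point_ge_1 by blast
  have TQ: "T \<ge> norm q" using S(5) Q by (smt (verit) power2_eq_square mult_left_mono mult_cancel_left1)
  show ?thesis
  proof (cases "x \<bullet> (p \<times> q) = 0")
    case True
    then obtain a b :: int where ab: "x = of_int a *\<^sub>R p + of_int b *\<^sub>R q"
      using int_point_in_plane[of p q r x] st x by (auto simp: stage_def)
    then have "a \<noteq> 0" using nz[of b] by auto
    then have a1: "\<bar>real_of_int a\<bar> \<ge> 1" by linarith
    have "1 * T \<le> (8 * norm p * norm x) * T"
      using P X T mult_mono[of 1 "norm p" 1 "norm x"] by (intro mult_right_mono) auto
    then have "1 / (8 * norm p * T * norm x) \<le> 1 / T"
      using P X T by (intro divide_left_mono) (auto simp: algebra_simps intro!: mult_pos_pos)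
    also have "\<dots> \<le> \<bar>of_int a\<bar> / T" using a1 T by (intro divide_right_mono) auto
    finally show ?thesis using stage_in_plane[OF st] ab by simp
  next
    case False
    have PX: "norm p \<le> norm p * norm x" "norm x \<le> norm p * norm x"
      using P X mult_left_mono[of 1 "norm x" "norm p"] mult_right_mono[of 1 "norm p" "norm x"]
      by simp_all
    have "(2 * norm p) * norm q \<le> (8 * norm p * norm x) * T"
      using P Q X T TQ PX by - (rule mult_mono; linarith)
    then have 1: "1 / (8 * norm p * T * norm x) \<le> 1 / (2 * norm p * norm q)"
      using P Q X T by (intro divide_left_mono) (auto simp: algebra_simps intro!: mult_pos_pos)
    have "(8 * norm x) * norm q \<le> (8 * norm p * norm x) * T"
      using P Q X T TQ PX by - (rule mult_mono; linarith)
    then have "1 / (8 * norm p * T * norm x) \<le> 1 / (8 * norm x * norm q)"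
      using P Q X T by (intro divide_left_mono) (auto simp: algebra_simps intro!: mult_pos_pos)
    then show ?thesis using 1 stage_off_plane[OF st x False] by linarith
  qed
qed

section \<open>Tuning the form of a stage and finding the next integer point\<close>

text \<open>Raising \<open>N\<close> by one raises the component of \<open>V\<close> along
  \<open>y\<close> by \<open>norm y \<le> h\<close>, so it can be brought between \<open>h\<close>
  and \<open>2 * h\<close>. The cross product \<open>V \<times> y\<close> does not depend on
  \<open>N\<close>, so the transversal part stays small; \<open>T\<close> is then
  \<open>norm V\<close>.\<close>

lemma stage_exists:
  assumes ints: "p \<in> int_points" "q \<in> int_points" "r \<in> int_points" and det: "p \<bullet> (q \<times> r) = 1"
    and PQ: "norm p \<le> norm q"
  obtains u T N where "stage p q u T r N" "u \<bullet> u0 \<ge> 0"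
proof -
  define y A h where "y = p \<times> q" and "A = q \<times> r" and "h = norm q powr (golden_ratio + 1)"
  have q0: "q \<noteq> 0" using det by auto
  have Q: "norm q \<ge> 1" using q0 ints norm_int_point_ge_1 by blast
  have "r \<bullet> y = 1" using triple_product_cyclic(2)[of p q r] det by (simp add: y_def)
  then have y0: "y \<noteq> 0" by auto
  then have y1: "norm y \<ge> 1" using ints norm_int_point_ge_1 by (simp add: y_def int_points_cross)
  have hQ: "(norm q)\<^sup>2 \<le> h" using square_le_powr_golden[OF Q] by (simp add: h_def)
  have Q2: "norm q \<le> (norm q)\<^sup>2" "1 \<le> (norm q)\<^sup>2" using Q by (simp_all add: self_le_power)
  have "norm y \<le> norm q * norm q"
    using norm_cross_le[of p q] PQ mult_right_mono[of "norm p" "norm q" "norm q"] by (simp add: y_def)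
  then have yh: "norm y \<le> h" using hQ by (simp add: power2_eq_square)
  \<comment> \<open>The real value of \<open>N\<close> for which the component of \<open>V\<close>
    along \<open>y\<close> is exactly \<open>h\<close>.\<close>
  define s where "s = (h - A \<bullet> y / norm y) / norm y - sqrt 2"
  define N where "N = \<lceil>s\<rceil>"
  define V where "V = A + (of_int N + sqrt 2) *\<^sub>R y"
  have "V \<bullet> y / norm y = A \<bullet> y / norm y + (of_int N + sqrt 2) * norm y"
    using y0 by (simp add: V_def inner_add_left add_divide_distrib dot_square_norm power2_eq_square)
  moreover have "s \<le> of_int N" "of_int N \<le> s + 1" unfolding N_def by linarith+
  moreover have "(s + sqrt 2) * norm y = h - A \<bullet> y / norm y" using y0 by (simp add: s_def)
  ultimately have Vy: "h \<le> V \<bullet> y / norm y" "V \<bullet> y / norm y \<le> h + norm y"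
    using mult_right_mono[of s "of_int N" "norm y"] mult_right_mono[of "of_int N" "s + 1" "norm y"]
    by (simp_all add: algebra_simps)
  have h0: "h > 0" using hQ Q2 by linarith
  have "A \<times> y = - (p \<bullet> (q \<times> r)) *\<^sub>R q"
    by (simp add: A_def y_def vec_eq_iff forall_3 cross_components inner_vec_def sum_3 algebra_simps)
  then have "V \<times> y = - q" using det by (simp add: V_def cross_add_left cross_mult_left)
  then have "norm (V \<times> y) / norm y \<le> norm q"
    using y1 Q mult_left_mono[of 1 "norm y" "norm q"] by (simp add: divide_le_eq)
  moreover have "\<bar>V \<bullet> y\<bar> / norm y \<le> h + norm y" using Vy h0 y1 by (simp add: field_simps abs_if)
  ultimately have up: "norm V \<le> 4 * h"
    using norm_le_component_plus_cross[OF y0, of V] yh hQ Q2 h0 by linarith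
  have "\<bar>V \<bullet> y\<bar> / norm y \<le> norm V" using Cauchy_Schwarz_ineq2[of V y] y0 by (simp add: field_simps)
  then have lo: "h \<le> norm V" using Vy y1 by (smt (verit) divide_right_mono norm_ge_zero)
  have V0: "norm V > 0" using lo h0 by linarith
  define u where "u = (if V \<bullet> u0 \<ge> 0 then V /\<^sub>R norm V else - (V /\<^sub>R norm V))"
  have V: "V = q \<times> (r - (of_int N + sqrt 2) *\<^sub>R p)"
    by (simp add: V_def A_def y_def vec_eq_iff forall_3 cross_components algebra_simps)
  have "norm V *\<^sub>R u = V \<or> norm V *\<^sub>R u = - V" using V0 by (simp add: u_def)
  then have "stage p q u (norm V) r N"
    using ints det lo up V0 unfolding stage_def V[symmetric] h_def by (simp add: u_def)
  moreover have "u \<bullet> u0 \<ge> 0"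
    using V0 by (auto simp: u_def zero_le_mult_iff mult_le_0_iff)
  ultimately show thesis using that by blast
qed

text \<open>For a good approximation \<open>h / c\<close> of \<theta>, the point
  \<open>q' = c r - h p + b q\<close> satisfies
  \<open>\<bar>q' \<bullet> u\<bar> = \<bar>c \<theta> - h\<bar> / T\<close>. Since
  \<open>r - \<theta> p\<close> lies in the plane of \<open>q\<close> and the projection
  \<open>t\<close> of \<open>p\<close> orthogonal to \<open>u\<close>, a suitable \<open>b\<close>
  leaves \<open>q'\<close> within bounded distance of a multiple of \<open>t\<close>, and
  \<open>t\<close> is close in direction to \<open>p\<close>. \<open>K\<close> depends on the stage
  alone, so \<open>B\<close> may be chosen after it.\<close>

lemma stage_next_point:
  assumes st: "stage p q u T r N" and Q8: "norm q \<ge> 8"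
  obtains K where "K > 0"
    "\<And>B. \<exists>q'\<in>int_points. \<exists>r'\<in>int_points. q \<bullet> (q' \<times> r') = 1 \<and> norm q' \<ge> B \<and>
       \<bar>q' \<bullet> u\<bar> \<le> K / norm q' \<and> norm (q' \<times> p) \<le> 2 * norm q' / T \<and> q' \<bullet> p \<ge> 0"
proof -
  let ?\<theta> = "of_int N + sqrt 2"
  note S = stage_basics[OF st]
  have ints: "p \<in> int_points" "q \<in> int_points" "r \<in> int_points" and det: "p \<bullet> (q \<times> r) = 1"
    and u1: "norm u = 1" using st by (auto simp: stage_def)
  have P: "norm p \<ge> 1" and T0: "T > 0" using S by auto
  have TQ: "T \<ge> 8 * norm q"
    using S(5) Q8 mult_right_mono[of 8 "norm q" "norm q"] by (simp add: power2_eq_square)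
  define z t where "z = r - ?\<theta> *\<^sub>R p" and "t = p - (p \<bullet> u) *\<^sub>R u"
  define D where "D = p \<bullet> (q \<times> u)"
  \<comment> \<open>\<open>p \<times> q\<close> has norm at least 1 and its part orthogonal to
    \<open>u\<close> has norm below 1, so \<open>D\<close> cannot vanish and \<open>p\<close>,
    \<open>q\<close>, \<open>u\<close> form a basis.\<close>
  have "D\<^sup>2 = (norm (p \<times> q))\<^sup>2 - (norm ((p \<times> q) \<times> u))\<^sup>2"
    using norm_cross[of "p \<times> q" u] u1 triple_product_cyclic(2)[of p q u]
    by (simp add: D_def inner_commute)
  moreover have "norm q / T < 1" using TQ Q8 T0 by (simp add: divide_less_eq)
  then have "(norm q / T)\<^sup>2 < 1" using T0 by (simp add: power_less_one_iff)
  moreover have "(norm (p \<times> q))\<^sup>2 \<ge> 1" using S(11) by simp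
  ultimately have "D\<^sup>2 > 0" using S(10) by simp
  then have D0: "D \<noteq> 0" by auto
  have zq: "T *\<^sub>R u = q \<times> z \<or> T *\<^sub>R u = - (q \<times> z)" using st by (simp add: stage_def z_def)
  have "T * (u \<bullet> z) = 0"
    using zq by (metis dot_cross_self(3) inner_minus_left inner_scaleR_left neg_equal_0_iff_equal)
  then have uz: "u \<bullet> z = 0" using T0 by simp
  have "u \<bullet> (q \<times> z) = T \<or> u \<bullet> (q \<times> z) = - T"
    using zq u1 by (metis dot_square_norm inner_minus_right inner_scaleR_right minus_minus
        mult.right_neutral one_power2)
  moreover have "z \<bullet> (q \<times> u) = - (u \<bullet> (q \<times> z))"
    by (simp add: cross_components inner_vec_def sum_3 algebra_simps)
  ultimately have zqu: "z \<bullet> (q \<times> u) \<noteq> 0" using T0 by auto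
  define \<alpha> \<mu> \<nu> where "\<alpha> = (z \<bullet> (q \<times> u)) / D" and "\<mu> = (p \<bullet> (z \<times> u)) / D"
    and "\<nu> = (p \<bullet> (q \<times> z)) / D"
  have \<alpha>0: "\<alpha> \<noteq> 0" using zqu D0 by (simp add: \<alpha>_def)
  have "D *\<^sub>R z = D *\<^sub>R (\<alpha> *\<^sub>R p + \<mu> *\<^sub>R q + \<nu> *\<^sub>R u)"
    using triple_product_expansion[of p q u z] D0
    by (simp add: D_def \<alpha>_def \<mu>_def \<nu>_def scaleR_add_right)
  then have z1: "z = \<alpha> *\<^sub>R p + \<mu> *\<^sub>R q + \<nu> *\<^sub>R u" using D0 by simp
  have "0 = \<alpha> * (p \<bullet> u) + \<nu>"
    using uz S(7) u1 by (simp add: z1 inner_add_right inner_commute dot_square_norm)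
  then have "\<nu> = - (\<alpha> * (p \<bullet> u))" by simp
  then have z2: "z = \<alpha> *\<^sub>R t + \<mu> *\<^sub>R q" by (simp add: z1 t_def scaleR_diff_right)
  have tu: "t \<bullet> u = 0" using u1 by (simp add: t_def inner_diff_left dot_square_norm)
  have "norm p \<le> norm t + \<bar>p \<bullet> u\<bar>"
    using norm_triangle_ineq[of t "(p \<bullet> u) *\<^sub>R u"] u1 by (simp add: t_def)
  moreover have "1 / T < 1" using TQ Q8 T0 by (simp add: divide_less_eq)
  ultimately have t0: "norm t > 0" using S(9) P by linarith
  define W where "W = norm p + norm q"
  have W0: "W > 0" using P Q8 by (simp add: W_def)
  define k where "k = \<bar>\<alpha>\<bar> * norm t"
  have k0: "k > 0" using \<alpha>0 t0 by (simp add: k_def)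
  define K where "K = (k + W) / T"
  have K0: "K > 0" using k0 W0 T0 by (simp add: K_def)
  have main: "\<exists>q'\<in>int_points. \<exists>r'\<in>int_points. q \<bullet> (q' \<times> r') = 1 \<and> norm q' \<ge> B \<and>
       \<bar>q' \<bullet> u\<bar> \<le> K / norm q' \<and> norm (q' \<times> p) \<le> 2 * norm q' / T" for B
  proof -
    \<comment> \<open>The term \<open>T * W * norm t\<close> makes the bounded remainder
      \<open>V\<close> harmless in the estimate of \<open>q' \<times> p\<close>.\<close>
    define B' where "B' = max B (max 1 (T * W * norm t))"
    obtain n :: nat where n: "real n > 4 * ((B' + W) / k)" and n0: "n > 0"
      using reals_Archimedean2[of "max 0 (4 * ((B' + W) / k))"] by (auto simp: max_def split: if_splits)
    obtain h c where hc: "coprime h c" "0 < c" "c \<le> int n" "\<bar>of_int c * ?\<theta> - of_int h\<bar> < 1 / real n"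
      using Dirichlet_approx_coprime[OF n0] by metis
    \<comment> \<open>Dirichlet's theorem only gives \<open>c \<le> n\<close>. Bad approximability
      forces \<open>c > n / 4\<close>, which makes \<open>norm q'\<close> as large as
      desired.\<close>
    have "1 / (4 * \<bar>real_of_int c\<bar>) \<le> \<bar>of_int c * sqrt 2 + of_int (c * N - h)\<bar>"
      using hc(2) by (intro sqrt2_form_lower_bound) auto
    also have "of_int c * sqrt 2 + of_int (c * N - h) = of_int c * ?\<theta> - of_int h"
      by (simp add: algebra_simps)
    finally have "1 / (4 * real_of_int c) < 1 / real n" using hc by simp
    then have "real n < 4 * real_of_int c" using hc(2) n0 by (simp add: field_simps)
    then have "(B' + W) / k \<le> of_int c" using n by linarith
    then have ck: "B' + W \<le> of_int c * k" using k0 by (simp add: field_simps)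
    have c1: "real_of_int c \<ge> 1" using hc(2) by linarith
    define \<epsilon> where "\<epsilon> = of_int c * ?\<theta> - of_int h"
    have "1 / real n \<le> 1 / of_int c" using hc(2,3) by (intro divide_left_mono) auto
    then have \<epsilon>: "\<bar>\<epsilon>\<bar> \<le> 1 / of_int c" using hc(4) by (simp add: \<epsilon>_def)
    moreover have "1 / real_of_int c \<le> 1" using c1 by simp
    ultimately have \<epsilon>1: "\<bar>\<epsilon>\<bar> \<le> 1" by linarith
    \<comment> \<open>Rounding cancels the component along \<open>q\<close> up to a coefficient of
      absolute value at most 1.\<close>
    define b where "b = - round (of_int c * \<mu>)"
    have b: "\<bar>of_int c * \<mu> + of_int b\<bar> \<le> 1"
      using of_int_round_abs_le[of "of_int c * \<mu>"] by (simp add: b_def abs_minus_commute)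
    define q' where "q' = of_int (- h) *\<^sub>R p + of_int b *\<^sub>R q + of_int c *\<^sub>R r"
    define V where "V = (of_int c * \<mu> + of_int b) *\<^sub>R q + \<epsilon> *\<^sub>R p"
    have "r = \<alpha> *\<^sub>R t + \<mu> *\<^sub>R q + ?\<theta> *\<^sub>R p" using z2 by (simp add: z_def algebra_simps)
    then have q': "q' = (of_int c * \<alpha>) *\<^sub>R t + V"
      by (simp add: q'_def V_def \<epsilon>_def algebra_simps)
    have "norm V \<le> \<bar>of_int c * \<mu> + of_int b\<bar> * norm q + \<bar>\<epsilon>\<bar> * norm p"
      unfolding V_def by (metis norm_scaleR norm_triangle_ineq)
    also have "\<dots> \<le> 1 * norm q + 1 * norm p"
      using b \<epsilon>1 by (intro add_mono mult_right_mono) auto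
    finally have VW: "norm V \<le> W" by (simp add: W_def)
    have nt: "norm ((of_int c * \<alpha>) *\<^sub>R t) = of_int c * k" using c1 by (simp add: k_def abs_mult)
    have Q'B: "norm q' \<ge> B'"
      using norm_triangle_ineq4[of q' V] q' nt VW ck by simp
    then have Q'1: "norm q' \<ge> 1" "norm q' \<ge> B" "norm q' \<ge> T * W * norm t" by (simp_all add: B'_def)
    have "norm q' \<le> of_int c * k + W"
      using norm_triangle_ineq[of "(of_int c * \<alpha>) *\<^sub>R t" V] q' nt VW by simp
    also have "\<dots> \<le> of_int c * (k + W)" using c1 W0 mult_right_mono[of 1 "of_int c" W] by (simp add: distrib_left)
    finally have Q'up: "norm q' \<le> of_int c * (k + W)" .
    have "q' \<bullet> u = \<epsilon> * (p \<bullet> u)"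
      using tu S(7) by (simp add: q' V_def inner_add_left inner_commute[of q u])
    then have "\<bar>q' \<bullet> u\<bar> = \<bar>\<epsilon>\<bar> / T" using S(9) by (simp add: abs_mult)
    also have "\<dots> \<le> (1 / of_int c) / T" using \<epsilon> T0 by (intro divide_right_mono) auto
    also have "\<dots> \<le> ((k + W) / norm q') / T"
    proof (rule divide_right_mono)
      have "norm q' > 0" "real_of_int c > 0" using Q'1(1) c1 by linarith+
      then show "1 / of_int c \<le> (k + W) / norm q'" using Q'up by (simp add: divide_simps mult.commute)
    qed (use T0 in simp)
    finally have q'u: "\<bar>q' \<bullet> u\<bar> \<le> K / norm q'" by (simp add: K_def mult.commute)
    have "q' \<times> p = V \<times> t + (p \<bullet> u) *\<^sub>R (q' \<times> u)"
    proof -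
      have "q' \<times> p = q' \<times> t + (p \<bullet> u) *\<^sub>R (q' \<times> u)"
        by (simp add: t_def Cross3.right_diff_distrib cross_mult_right)
      moreover have "q' \<times> t = V \<times> t" by (simp add: q' cross_add_left cross_mult_left)
      ultimately show ?thesis by simp
    qed
    then have "norm (q' \<times> p) \<le> norm (V \<times> t) + \<bar>p \<bullet> u\<bar> * norm (q' \<times> u)"
      by (metis norm_scaleR norm_triangle_ineq)
    also have "norm (V \<times> t) \<le> W * norm t"
      using norm_cross_le[of V t] mult_right_mono[OF VW, of "norm t"] by simp
    also have "W * norm t \<le> norm q' / T" using Q'1(3) T0 by (simp add: field_simps)
    also have "\<bar>p \<bullet> u\<bar> * norm (q' \<times> u) \<le> norm q' / T"
      using norm_cross_le[of q' u] u1 S(9) T0 by (simp add: divide_right_mono)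
    finally have q'p: "norm (q' \<times> p) \<le> 2 * norm q' / T" by simp
    \<comment> \<open>Coprimality of \<open>h\<close> and \<open>c\<close> supplies, through Bezout,
      a third vector completing \<open>q\<close> and \<open>q'\<close> to a basis.\<close>
    obtain s s' where "s * h + s' * c = 1"
      using bezout_int[of h c] hc(1) by (auto simp: coprime_iff_gcd_eq_1)
    then have ss: "of_int s * of_int h + of_int s' * of_int c = (1::real)"
      by (metis of_int_1 of_int_add of_int_mult)
    define r' where "r' = of_int s' *\<^sub>R p + of_int s *\<^sub>R r"
    have "q \<bullet> (q' \<times> r') = (of_int s * of_int h + of_int s' * of_int c) * (p \<bullet> (q \<times> r))"
      by (simp add: q'_def r'_def cross_components inner_vec_def sum_3 algebra_simps)
    then have "q \<bullet> (q' \<times> r') = 1" using ss det by simp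
    moreover have "q' \<in> int_points" "r' \<in> int_points"
      unfolding q'_def r'_def using ints by (auto intro!: int_points_add int_points_scaleR simp del: of_int_minus)
    ultimately show ?thesis using Q'1 q'u q'p by blast
  qed
  have "\<exists>q'\<in>int_points. \<exists>r'\<in>int_points. q \<bullet> (q' \<times> r') = 1 \<and> norm q' \<ge> B \<and>
       \<bar>q' \<bullet> u\<bar> \<le> K / norm q' \<and> norm (q' \<times> p) \<le> 2 * norm q' / T \<and> q' \<bullet> p \<ge> 0" for B
  proof -
    obtain q' r' where *: "q' \<in> int_points" "r' \<in> int_points" "q \<bullet> (q' \<times> r') = 1" "norm q' \<ge> B"
       "\<bar>q' \<bullet> u\<bar> \<le> K / norm q'" "norm (q' \<times> p) \<le> 2 * norm q' / T" using main by blast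
    show ?thesis
    proof (cases "q' \<bullet> p \<ge> 0")
      case True
      then show ?thesis using * by blast
    next
      case False
      then show ?thesis
        using * by (intro bexI[of _ "- q'"] bexI[of _ "- r'"]) (auto intro: int_points_uminus)
    qed
  qed
  then show thesis using that K0 by blast
qed

text \<open>Both \<open>u\<close> and \<open>u'\<close> are parallel to
  \<open>y = q \<times> q'\<close> up to a constant over the square of \<open>norm q'\<close>,
  because \<open>norm y\<close> is at least \<open>norm q' / (2 * norm p)\<close>. Hence they are
  that close to each other, and \<open>\<beta>'\<close> records this bound.\<close>

lemma stage_step:
  assumes st: "stage p q u T r N" and Q8: "norm q \<ge> 8" and \<beta>: "\<beta> > 0"
  obtains q' u' T' r' N' \<beta>' where "stage q q' u' T' r' N'" "norm q' \<ge> B"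
    "norm (q' /\<^sub>R norm q' - p /\<^sub>R norm p) \<le> 4 / (T * norm p)"
    "norm (u' - u) \<le> \<beta>'" "\<beta>' > 0" "\<beta>' \<le> \<beta> / 2"
    "\<And>X. X \<ge> 1 \<Longrightarrow> X powr golden_ratio \<le> norm q' \<Longrightarrow> \<beta>' * X\<^sup>2 \<le> 1 / (32 * norm p * T)"
proof -
  note S = stage_basics[OF st]
  have P: "norm p \<ge> 1" and T0: "T > 0" and u1: "norm u = 1" using S st by (auto simp: stage_def)
  obtain K where K: "K > 0"
    "\<And>B. \<exists>q'\<in>int_points. \<exists>r'\<in>int_points. q \<bullet> (q' \<times> r') = 1 \<and> norm q' \<ge> B \<and>
       \<bar>q' \<bullet> u\<bar> \<le> K / norm q' \<and> norm (q' \<times> p) \<le> 2 * norm q' / T \<and> q' \<bullet> p \<ge> 0"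
    using stage_next_point[OF st Q8] by metis
  define L where "L = 4 * norm p * (1 + norm q * K)"
  have L0: "L > 0" using P K(1) Q8 unfolding L_def
    by (smt (verit) mult_pos_pos)
  define c where "c = 1 / (32 * norm p * T)"
  have c0: "c > 0" using P T0 unfolding c_def by (smt (verit) divide_pos_pos mult_pos_pos)
  \<comment> \<open>\<open>norm q\<close> serves the hypothesis of \<open>stage_exists\<close>,
    \<open>2 * L / \<beta>\<close> the halving, and the power of \<open>L / c\<close> the last
    conclusion.\<close>
  define B' where "B' = max (max B (norm q)) (max (2 * L / \<beta>) ((L / c) powr (3 / 2)))"
  obtain q' r' where q': "q' \<in> int_points" "r' \<in> int_points" "q \<bullet> (q' \<times> r') = 1" "norm q' \<ge> B'"
       "\<bar>q' \<bullet> u\<bar> \<le> K / norm q'" "norm (q' \<times> p) \<le> 2 * norm q' / T" "q' \<bullet> p \<ge> 0"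
    using K(2)[of B'] by blast
  let ?Q = "norm q'"
  have QB: "?Q \<ge> B" "?Q \<ge> norm q" "?Q \<ge> 2 * L / \<beta>" "?Q \<ge> (L / c) powr (3 / 2)"
    using q'(4) by (simp_all add: B'_def)
  have Q1: "?Q \<ge> 8" using QB Q8 by linarith
  obtain u' T' N' where st': "stage q q' u' T' r' N'" and uu: "u' \<bullet> u \<ge> 0"
    using stage_exists[of q q' r' u] q' QB(2) st by (auto simp: stage_def)
  note S' = stage_basics[OF st']
  define e e' f where "e = p /\<^sub>R norm p" and "e' = q' /\<^sub>R ?Q" and "f = q /\<^sub>R norm q"
  have n1: "norm e = 1" "norm e' = 1" "norm f = 1" using S(1,2) S'(2) by (simp_all add: e_def e'_def f_def)
  have "norm (e' \<times> e) = norm (q' \<times> p) / (?Q * norm p)"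
    by (simp add: e_def e'_def cross_mult_left cross_mult_right divide_inverse mult.commute)
  also have "\<dots> \<le> (2 * ?Q / T) / (?Q * norm p)" using q'(6) by (intro divide_right_mono) auto
  also have "\<dots> = 2 / (T * norm p)" using Q1 by (auto simp: field_simps)
  finally have "norm (e' \<times> e) \<le> 2 / (T * norm p)" .
  moreover have "e' \<bullet> e \<ge> 0" using q'(7) by (simp add: e_def e'_def)
  ultimately have ee: "norm (e' - e) \<le> 4 / (T * norm p)"
    using norm_diff_le_norm_cross[OF n1(2,1)] by simp
  define y where "y = q \<times> q'"
  \<comment> \<open>The sine of the angle between \<open>p\<close> and \<open>q\<close> is bounded
    below because \<open>norm (p \<times> q) \<ge> 1\<close>. The direction of \<open>q'\<close>
    differs from that of \<open>p\<close> by at most half of this bound.\<close>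
  have "norm (f \<times> e) = norm (p \<times> q) / (norm q * norm p)"
    using cross_skew[of p q]
    by (simp add: e_def f_def cross_mult_left cross_mult_right divide_inverse mult.commute)
  also have "\<dots> \<ge> 1 / (norm q * norm p)" using S(11) by (intro divide_right_mono) auto
  finally have "1 / (norm q * norm p) \<le> norm (f \<times> e)" .
  also have "\<dots> \<le> norm (f \<times> e') + 4 / (T * norm p)"
    using norm_cross_unit_diff(2)[OF n1(3), of e e'] ee by (simp add: norm_minus_commute)
  finally have "1 / (norm q * norm p) \<le> norm (f \<times> e') + 4 / (T * norm p)" .
  moreover have "4 / (T * norm p) \<le> 1 / (2 * (norm q * norm p))"
  proof -
    have "8 * norm q \<le> T" using S(5) Q8 mult_right_mono[of 8 "norm q" "norm q"] by (simp add: power2_eq_square)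
    moreover have "norm p > 0" "norm q > 0" using P Q8 by linarith+
    ultimately show ?thesis using T0 by (simp add: divide_simps mult_ac)
  qed
  ultimately have "1 / (2 * (norm q * norm p)) \<le> norm (f \<times> e')" by (simp add: field_simps)
  also have "\<dots> = norm y / (norm q * ?Q)"
    by (simp add: y_def e'_def f_def cross_mult_left cross_mult_right divide_inverse mult.commute)
  finally have "1 / (2 * (norm q * norm p)) \<le> norm y / (norm q * ?Q)" .
  moreover have pos: "norm p > 0" "norm q > 0" "?Q > 0" using P Q8 Q1 by linarith+
  ultimately have "norm q * ?Q \<le> norm q * (2 * norm p * norm y)"
    by (simp add: divide_simps mult_ac)
  then have ylow: "?Q \<le> 2 * norm p * norm y" using pos mult_le_cancel_left_pos by blast
  have y1: "norm y \<ge> 1" using S'(11) by (simp add: y_def)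
  define Y where "Y = y /\<^sub>R norm y"
  have "y \<noteq> 0" using y1 by auto
  then have nY: "norm Y = 1" by (simp add: Y_def)
  have u'1: "norm u' = 1" using st' by (simp add: stage_def)
  have y2: "1 / norm y \<le> 2 * norm p / ?Q" using ylow pos \<open>y \<noteq> 0\<close> by (simp add: divide_simps mult_ac)
  have "norm (Y \<times> u') = (1 / norm y) * (?Q / T')"
    using S'(10) by (simp add: Y_def y_def cross_mult_left divide_inverse)
  also have "\<dots> \<le> (2 * norm p / ?Q) * (1 / ?Q)"
  proof (rule mult_mono)
    have "T' > 0" using S'(6) by linarith
    then show "?Q / T' \<le> 1 / ?Q" using S'(5) pos by (simp add: divide_simps power2_eq_square)
  qed (use y2 S'(6) P in auto)
  finally have a1: "norm (u' \<times> Y) \<le> 2 * norm p / ?Q\<^sup>2"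
    using cross_skew[of Y u'] by (simp add: power2_eq_square)
  have "y \<times> u = (q \<bullet> u) *\<^sub>R q' - (q' \<bullet> u) *\<^sub>R q"
    by (simp add: y_def vec_eq_iff forall_3 cross_components inner_vec_def sum_3 algebra_simps)
  then have "norm (y \<times> u) = \<bar>q' \<bullet> u\<bar> * norm q" using S(7) by (simp add: inner_commute)
  then have "norm (Y \<times> u) = (1 / norm y) * (\<bar>q' \<bullet> u\<bar> * norm q)"
    by (simp add: Y_def cross_mult_left divide_inverse)
  also have "\<dots> \<le> (2 * norm p / ?Q) * (K / ?Q * norm q)"
    using y2 q'(5) by (intro mult_mono mult_right_mono) auto
  finally have a2: "norm (Y \<times> u) \<le> 2 * norm p * (norm q * K) / ?Q\<^sup>2" by (simp add: power2_eq_square mult_ac)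
  have "norm (u' - u) \<le> 2 * norm (u' \<times> u)" using norm_diff_le_norm_cross[OF u'1 u1 uu] .
  also have "\<dots> \<le> 2 * (2 * norm p / ?Q\<^sup>2 + 2 * norm p * (norm q * K) / ?Q\<^sup>2)"
    using order_trans[OF norm_cross_triangle[OF u'1 nY u1] add_mono[OF a1 a2]]
    by (rule mult_left_mono) simp
  also have "\<dots> = L / ?Q\<^sup>2" by (simp add: L_def add_divide_distrib algebra_simps)
  finally have uL: "norm (u' - u) \<le> L / ?Q\<^sup>2" .
  have "L / ?Q\<^sup>2 \<le> L / ?Q" using Q1 L0 S'(2) by (intro divide_left_mono) (auto simp: self_le_power)
  also have "\<dots> \<le> \<beta> / 2" using QB(3) \<beta> pos by (simp add: divide_simps mult_ac)
  finally have half: "L / ?Q\<^sup>2 \<le> \<beta> / 2" .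
  have fin: "L / ?Q\<^sup>2 * X\<^sup>2 \<le> c" if X: "X \<ge> 1" "X powr golden_ratio \<le> ?Q" for X
  proof -
    \<comment> \<open>As \<gamma> exceeds 3/2, \<open>X\<^sup>2\<close> is at most
      \<open>?Q powr (4 / 3)\<close>; the remaining exponent 2/3 absorbs
      \<open>L / c\<close>.\<close>
    have "X powr (3 / 2) \<le> X powr golden_ratio" using X golden_ratio_bounds by (intro powr_mono) auto
    then have "X powr (3 / 2) \<le> ?Q" using X by linarith
    then have "(X powr (3 / 2)) powr (4 / 3) \<le> ?Q powr (4 / 3)" by (intro powr_mono2) auto
    then have X2: "X\<^sup>2 \<le> ?Q powr (4 / 3)" using X by (simp add: powr_powr)
    have "((L / c) powr (3 / 2)) powr (2 / 3) \<le> ?Q powr (2 / 3)" using QB(4) by (intro powr_mono2) auto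
    then have "L / c \<le> ?Q powr (2 / 3)" using L0 c0 by (simp add: powr_powr)
    then have Lc: "L \<le> c * ?Q powr (2 / 3)" using c0 by (simp add: field_simps)
    have "L * X\<^sup>2 \<le> (c * ?Q powr (2 / 3)) * ?Q powr (4 / 3)"
      using X2 Lc L0 c0 by (intro mult_mono) auto
    also have "\<dots> = c * ?Q\<^sup>2" using Q1 by (simp add: mult.assoc flip: powr_add)
    finally show ?thesis using pos by (simp add: divide_simps)
  qed
  have "L / ?Q\<^sup>2 > 0" using L0 pos by simp
  from that[OF st' QB(1) ee[unfolded e_def e'_def] uL this half fin[unfolded c_def]]
  show thesis .
qed

section \<open>Geometrically convergent sequences and independence criteria\<close>

lemma geometric_steps_limit:
  fixes f :: "nat \<Rightarrow> 'a::banach"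
  assumes step: "\<And>n. norm (f (Suc n) - f n) \<le> b n" and half: "\<And>n. b (Suc n) \<le> b n / 2"
  obtains l where "f \<longlonglongrightarrow> l" "\<And>n. norm (l - f n) \<le> 2 * b n"
proof -
  have b0: "b n \<ge> 0" for n using step[of n] norm_ge_zero order_trans by blast
  \<comment> \<open>Subtracting \<open>2 * b (n + k)\<close> makes the induction close.\<close>
  have tel: "norm (f (n + k) - f n) \<le> 2 * b n - 2 * b (n + k)" for n k
  proof (induction k)
    case (Suc k)
    have "norm (f (n + Suc k) - f n) \<le> norm (f (Suc (n + k)) - f (n + k)) + norm (f (n + k) - f n)"
      using norm_triangle_ineq[of "f (Suc (n + k)) - f (n + k)" "f (n + k) - f n"] by simp
    then show ?case using Suc step[of "n + k"] half[of "n + k"] by simp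
  qed simp
  have le: "norm (f (n + k) - f n) \<le> 2 * b n" for n k using tel[of n k] b0[of "n + k"] by linarith
  have bpow: "b n \<le> b 0 * (1 / 2) ^ n" for n
  proof (induction n)
    case (Suc n)
    then show ?case using half[of n] by simp
  qed simp
  have "(\<lambda>n. b 0 * (1 / 2) ^ n) \<longlonglongrightarrow> b 0 * 0" by (intro tendsto_intros LIMSEQ_power_zero) simp
  then have "b \<longlonglongrightarrow> 0"
    using b0 bpow by (intro real_tendsto_sandwich[of "\<lambda>_. 0" b sequentially "\<lambda>n. b 0 * (1 / 2) ^ n"]) auto
  have "Cauchy f"
  proof (rule CauchyI)
    fix e :: real assume "e > 0"
    then have "\<forall>\<^sub>F n in sequentially. b n < e / 4" using \<open>b \<longlonglongrightarrow> 0\<close> by (intro order_tendstoD) auto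
    then obtain M where M: "b M < e / 4" by (auto simp: eventually_sequentially)
    show "\<exists>M. \<forall>m\<ge>M. \<forall>n\<ge>M. norm (f m - f n) < e"
    proof (intro exI allI impI)
      fix m n assume "m \<ge> M" "n \<ge> M"
      then have "norm (f m - f M) \<le> 2 * b M" "norm (f n - f M) \<le> 2 * b M"
        using le[of M "m - M"] le[of M "n - M"] by auto
      then show "norm (f m - f n) < e"
        using norm_triangle_ineq4[of "f m - f M" "f n - f M"] M by simp
    qed
  qed
  then obtain l where l: "f \<longlonglongrightarrow> l" using Cauchy_convergent convergent_def by blast
  have "norm (l - f n) \<le> 2 * b n" for n
  proof (rule LIMSEQ_le_const2)
    show "(\<lambda>k. norm (f (k + n) - f n)) \<longlonglongrightarrow> norm (l - f n)"
      using LIMSEQ_ignore_initial_segment[OF l, of n] by (intro tendsto_intros)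
    show "\<exists>N. \<forall>k\<ge>N. norm (f (k + n) - f n) \<le> 2 * b n" using le[of n] by (auto simp: add.commute)
  qed
  then show thesis using that l by blast
qed

lemma tendsto_cross3:
  fixes f g :: "'b \<Rightarrow> real ^ 3"
  assumes "(f \<longlongrightarrow> a) F" "(g \<longlongrightarrow> b) F"
  shows "((\<lambda>n. f n \<times> g n) \<longlongrightarrow> a \<times> b) F"
proof -
  have "bounded_bilinear (\<times>)" using bilinear_cross bilinear_conv_bounded_bilinear by blast
  then show ?thesis using assms by (rule bounded_bilinear.tendsto)
qed

lemma independent_orthogonal_cross:
  fixes u v w :: "real ^ 3"
  assumes "u \<noteq> 0" "u \<bullet> v = 0" "u \<bullet> w = 0" "v \<times> w \<noteq> 0"
  shows "distinct [u, v, w]" "independent {u, v, w}"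
proof -
  have vw: "v \<noteq> 0" "w \<noteq> 0" "v \<noteq> w" using assms(4) by auto
  then show "distinct [u, v, w]" using assms by auto
  have "v \<notin> span {w}" using assms(4) by (auto simp: span_singleton cross_mult_left)
  then have "independent {v, w}" using vw by (simp add: independent_insert)
  moreover have "u \<notin> span {v, w}"
  proof
    assume "u \<in> span {v, w}"
    then have "orthogonal u u" using assms by (intro orthogonal_to_span[of u "{v, w}" u]) (auto simp: orthogonal_def)
    then show False using assms(1) by (simp add: orthogonal_def)
  qed
  ultimately show "independent {u, v, w}" using vw by (simp add: independent_insert)
qed

text \<open>Clearing denominators turns a rational relation into a nonzero integer point orthogonal
  to \<open>u\<close>, whose multiples have arbitrarily large norm. So information on large integer
  points suffices.\<close>

lemma coords_lin_indep_ratI: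
  assumes nz: "\<And>a. a \<in> int_points \<Longrightarrow> norm a \<ge> B \<Longrightarrow> a \<bullet> u \<noteq> 0"
  shows "coords_lin_indep_rat u"
  unfolding coords_lin_indep_rat_def
proof (intro allI impI)
  fix q :: "3 \<Rightarrow> rat" and i
  assume sum0: "(\<Sum>i\<in>UNIV. of_rat (q i) * u $ i) = 0"
  show "q i = 0"
  proof (rule ccontr)
    assume "q i \<noteq> 0"
    define d where "d j = snd (quotient_of (q j))" for j
    have d0: "d j > 0" for j using quotient_of_denom_pos' by (simp add: d_def)
    have qd: "q j * of_int (d j) = of_int (fst (quotient_of (q j)))" for j
      using quotient_of_div[of "q j"] d0[of j] by (simp add: d_def field_simps prod_eq_iff)
    define k where "k = (\<Prod>j\<in>UNIV. d j)"
    have k0: "k > 0" using d0 by (simp add: k_def prod_pos)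
    have qk: "of_int k * q j \<in> \<int>" for j
    proof -
      have "k = d j * (\<Prod>j\<in>UNIV - {j}. d j)" unfolding k_def by (simp add: prod.remove[of UNIV j])
      then have "of_int k * q j = of_int (fst (quotient_of (q j)) * (\<Prod>j\<in>UNIV - {j}. d j))"
        using qd[of j] by (simp add: mult_ac)
      then show ?thesis by (metis Ints_of_int)
    qed
    define a :: "real ^ 3" where "a = (\<chi> j. of_rat (of_int k * q j))"
    have a: "a \<in> int_points"
    proof -
      have "of_rat (of_int k * q j) \<in> (\<int> :: real set)" for j
        using qk[of j] by (metis Ints_cases Ints_of_int of_rat_of_int_eq)
      then show ?thesis by (simp add: int_points_def a_def)
    qed
    have "a $ i \<noteq> 0" using k0 \<open>q i \<noteq> 0\<close> by (simp add: a_def)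
    then have "a \<noteq> 0" by auto
    then have a1: "norm a \<ge> 1" using a norm_int_point_ge_1 by blast
    have "a \<bullet> u = of_int k * (\<Sum>i\<in>UNIV. of_rat (q i) * u $ i)"
      by (simp add: a_def inner_vec_def sum_distrib_left of_rat_mult mult.assoc)
    then have au: "a \<bullet> u = 0" using sum0 by simp
    obtain n :: nat where n: "real n \<ge> B" using real_arch_simple by blast
    have "norm (real n *\<^sub>R a) \<ge> B" using n a1 mult_left_mono[of 1 "norm a" "real n"] by simp
    moreover have "real n *\<^sub>R a \<in> int_points" using a by (intro int_points_scaleR) auto
    ultimately show False using nz[of "real n *\<^sub>R a"] au by simp
  qed
qed

section \<open>The infinite sequence of stages and its limit vectors\<close>

text \<open>Here \<open>2 * \<beta> (Suc n)\<close> bounds the distance from \<open>u n\<close> to the limit.\<close>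

locale golden_tower =
  fixes x u :: "nat \<Rightarrow> real ^ 3" and T \<beta> :: "nat \<Rightarrow> real"
  assumes stages: "\<And>n. \<exists>r N. stage (x n) (x (Suc n)) (u n) (T n) r N"
    and growth: "\<And>n. 8 * norm (x n) \<le> norm (x (Suc n))"
    and start: "64 \<le> norm (x 1)"
    and x_step: "\<And>n. norm (x (n + 2) /\<^sub>R norm (x (n + 2)) - x n /\<^sub>R norm (x n)) \<le> 4 / (T n * norm (x n))"
    and u_step: "\<And>n. norm (u (Suc n) - u n) \<le> \<beta> (Suc n)"
    and \<beta>_half: "\<And>n. \<beta> (Suc n) \<le> \<beta> n / 2"
    and \<beta>_small: "\<And>n X. X \<ge> 1 \<Longrightarrow> X powr golden_ratio \<le> norm (x (n + 2)) \<Longrightarrow>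
        \<beta> (Suc n) * X\<^sup>2 \<le> 1 / (32 * norm (x n) * T n)"
begin

definition e where "e n = x n /\<^sub>R norm (x n)"

text \<open>\<open>E n\<close> bounds the step from \<open>e n\<close> to \<open>e (n + 2)\<close>;
  twice as much bounds the distance from \<open>e n\<close> to its limit direction.\<close>

definition E where "E n = 4 / (T n * norm (x n))"

text \<open>Half the sine of the first angle. It depends only on \<open>x 0\<close> and
  \<open>x 1\<close>, so it is known before the growth of the later points is fixed.\<close>

definition \<eta> where "\<eta> = norm (e 0 \<times> e 1) / 2"

lemma x_int: "x n \<in> int_points" and x_ge_1: "norm (x n) \<ge> 1" and x_nz: "x n \<noteq> 0" and T_ge_1: "T n \<ge> 1"
  and T_ge: "T n \<ge> norm (x (Suc n)) powr (golden_ratio + 1)"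
  and T_le: "T n \<le> 4 * norm (x (Suc n)) powr (golden_ratio + 1)"
  and T_ge_square: "T n \<ge> (norm (x (Suc n)))\<^sup>2"
  and u_norm: "norm (u n) = 1" and u_orth: "u n \<bullet> x (Suc n) = 0"
  and x_u: "\<bar>x n \<bullet> u n\<bar> = 1 / T n"
  and cross_ge_1: "norm (x n \<times> x (Suc n)) \<ge> 1"
proof -
  obtain r N where st: "stage (x n) (x (Suc n)) (u n) (T n) r N" using stages by blast
  show "x n \<in> int_points" "norm (x n) \<ge> 1" "x n \<noteq> 0" "T n \<ge> 1" "norm (u n) = 1" "u n \<bullet> x (Suc n) = 0"
    "T n \<ge> norm (x (Suc n)) powr (golden_ratio + 1)" "T n \<le> 4 * norm (x (Suc n)) powr (golden_ratio + 1)"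
    "T n \<ge> (norm (x (Suc n)))\<^sup>2" "\<bar>x n \<bullet> u n\<bar> = 1 / T n" "norm (x n \<times> x (Suc n)) \<ge> 1"
    using stage_basics[OF st] st[unfolded stage_def] by blast+
qed

lemma e_norm: "norm (e n) = 1"
  using x_nz[of n] by (simp add: e_def)

lemma E_pos: "E n > 0"
  using T_ge_1[of n] x_ge_1[of n] by (auto simp: E_def intro!: divide_pos_pos mult_pos_pos)

lemma E_half: "E (Suc n) \<le> E n / 2"
proof -
  let ?g = "golden_ratio + 1"
  have x0: "norm (x n) > 0" using x_ge_1[of n] by linarith
  have T0: "T n > 0" using T_ge_1[of n] by linarith
  have "T n \<le> 4 * T (Suc n)"
  proof -
    have "norm (x (Suc n)) powr ?g \<le> norm (x (Suc (Suc n))) powr ?g"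
      using growth[of "Suc n"] norm_ge_zero[of "x (Suc n)"] golden_ratio_bounds
      by (intro powr_mono2) linarith+
    then show ?thesis using T_le[of n] T_ge[of "Suc n"] by linarith
  qed
  then have "2 * T n * norm (x n) \<le> (8 * T (Suc n)) * norm (x n)" using x0 by (intro mult_right_mono) auto
  also have "\<dots> = T (Suc n) * (8 * norm (x n))" by simp
  also have "\<dots> \<le> T (Suc n) * norm (x (Suc n))" using growth[of n] T_ge_1[of "Suc n"] by (intro mult_left_mono) auto
  finally have "4 / (T (Suc n) * norm (x (Suc n))) \<le> 4 / (2 * T n * norm (x n))"
    using x0 T0 T_ge_1[of "Suc n"] x_ge_1[of "Suc n"]
    by (intro divide_left_mono mult_pos_pos) linarith+
  then show ?thesis by (simp add: E_def)
qed

text \<open>A nonzero integer cross product bounds \<eta> below by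
  \<open>1 / (2 * (?P * ?Q))\<close>, while \<open>T 0 \<ge> 64 * ?Q\<close> makes
  \<open>E 0\<close> smaller than that.\<close>

lemma E_0: "E 0 \<le> \<eta> / 8" and \<eta>_pos: "\<eta> > 0"
proof -
  let ?P = "norm (x 0)" and ?Q = "norm (x 1)"
  have P: "?P > 0" and Q: "?Q > 0" using x_ge_1[of 0] start by linarith+
  have "norm (e 0 \<times> e 1) = norm (x 0 \<times> x 1) / (?P * ?Q)"
    by (simp add: e_def cross_mult_left cross_mult_right divide_inverse mult_ac)
  moreover have "1 / (?P * ?Q) \<le> norm (x 0 \<times> x 1) / (?P * ?Q)"
    using cross_ge_1[of 0] by (intro divide_right_mono) auto
  ultimately have \<eta>: "1 / (2 * (?P * ?Q)) \<le> \<eta>" by (simp add: \<eta>_def)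
  have "64 * ?Q \<le> T 0" using T_ge_square[of 0] start mult_right_mono[of 64 ?Q ?Q] by (simp add: power2_eq_square)
  then have "64 * ?Q * ?P \<le> T 0 * ?P" using P by (intro mult_right_mono) auto
  then have "4 / (T 0 * ?P) \<le> 4 / (64 * ?Q * ?P)"
    using P Q T_ge_1[of 0] by (intro divide_left_mono mult_pos_pos) linarith+
  also have "\<dots> = (1 / (2 * (?P * ?Q))) / 8" by simp
  finally show "E 0 \<le> \<eta> / 8" using \<eta> by (simp add: E_def)
  have "0 < 1 / (2 * (?P * ?Q))" using P Q by simp
  then show "\<eta> > 0" using \<eta> by linarith
qed

lemma e_cross: "norm (e n \<times> e (Suc n)) \<ge> \<eta>"
proof -
  \<comment> \<open>Each step replaces one of the two directions at a cost of at most
    \<open>E n\<close>; the term \<open>2 * E n\<close> reserves room for all losses still to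
    come.\<close>
  have "norm (e n \<times> e (Suc n)) \<ge> 2 * \<eta> - 2 * E 0 + 2 * E n"
  proof (induction n)
    case 0
    then show ?case by (simp add: \<eta>_def)
  next
    case (Suc n)
    have "norm (e n \<times> e (Suc n)) = norm (e (Suc n) \<times> e n)" using cross_skew[of "e n" "e (Suc n)"] by simp
    also have "\<dots> \<le> norm (e (Suc n) \<times> e (Suc (Suc n))) + norm (e n - e (Suc (Suc n)))"
      by (rule norm_cross_unit_diff(2)[OF e_norm])
    finally show ?case
      using Suc x_step[of n] E_half[of n] by (simp add: E_def e_def norm_minus_commute)
  qed
  then show ?thesis using E_0 \<eta>_pos E_pos[of n] by linarith
qed

text \<open>Directions of even and of odd index converge separately, since \<open>x (n + 2)\<close>
  follows the direction of \<open>x n\<close>. Besides the exact relations only tail estimates are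
  recorded; the later bounds are read off from them.\<close>

definition is_limit where
  "is_limit U v w \<longleftrightarrow> norm U = 1 \<and> norm v = 1 \<and> norm w = 1 \<and> U \<bullet> v = 0 \<and> U \<bullet> w = 0 \<and> v \<times> w \<noteq> 0 \<and>
     (\<forall>n. norm (U - u n) \<le> 2 * \<beta> (Suc n)) \<and>
     (\<forall>n. norm ((if even n then v else w) - e n) \<le> 2 * E n)"

lemma limit_exists: obtains U v w where "is_limit U v w"
proof -
  obtain U where U: "u \<longlonglongrightarrow> U" "\<And>n. norm (U - u n) \<le> 2 * \<beta> (Suc n)"
    using geometric_steps_limit[of u "\<lambda>n. \<beta> (Suc n)"] u_step \<beta>_half by blast
  have ex: "\<exists>l. (\<lambda>k. e (i + 2 * k)) \<longlonglongrightarrow> l \<and> (\<forall>k. norm (l - e (i + 2 * k)) \<le> 2 * E (i + 2 * k))" for i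
  proof -
    have 1: "norm (e (i + 2 * Suc k) - e (i + 2 * k)) \<le> E (i + 2 * k)" for k
      using x_step[of "i + 2 * k"] by (simp add: e_def E_def)
    have 2: "E (i + 2 * Suc k) \<le> E (i + 2 * k) / 2" for k
      using E_half[of "i + 2 * k"] E_half[of "Suc (i + 2 * k)"] E_pos[of "Suc (i + 2 * k)"] by simp
    show ?thesis
      using geometric_steps_limit[of "\<lambda>k. e (i + 2 * k)" "\<lambda>k. E (i + 2 * k)"] 1 2 by metis
  qed
  obtain v where v: "(\<lambda>k. e (2 * k)) \<longlonglongrightarrow> v" "\<And>k. norm (v - e (2 * k)) \<le> 2 * E (2 * k)"
    using ex[of 0] by auto
  obtain w where w: "(\<lambda>k. e (1 + 2 * k)) \<longlonglongrightarrow> w" "\<And>k. norm (w - e (1 + 2 * k)) \<le> 2 * E (1 + 2 * k)"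
    using ex[of 1] by auto
  have unit: "norm l = 1" if "f \<longlonglongrightarrow> l" "\<And>n. norm (f n) = 1" for f :: "nat \<Rightarrow> real ^ 3" and l
    using tendsto_norm[OF that(1)] that(2) by (simp add: LIMSEQ_const_iff)
  have orth: "u n \<bullet> e (Suc n) = 0" for n using u_orth by (simp add: e_def)
  have sub: "(\<lambda>k. u (c + 2 * k)) \<longlonglongrightarrow> U" for c
    using LIMSEQ_subseq_LIMSEQ[OF U(1), of "\<lambda>k. c + 2 * k"] by (simp add: strict_mono_def comp_def)
  have "(\<lambda>k. u (2 * k) \<bullet> e (1 + 2 * k)) \<longlonglongrightarrow> U \<bullet> w"
    using sub[of 0] w(1) by (intro tendsto_intros) auto
  then have Uw: "U \<bullet> w = 0" using orth by (simp add: LIMSEQ_const_iff)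
  \<comment> \<open>\<open>u n\<close> is orthogonal to \<open>x (n + 1)\<close>, so each odd index
    of \<open>u\<close> is paired with the next even point.\<close>
  have "(\<lambda>k. u (1 + 2 * k) \<bullet> e (2 * Suc k)) \<longlonglongrightarrow> U \<bullet> v"
    using sub[of 1] LIMSEQ_Suc[OF v(1)] by (intro tendsto_intros)
  then have Uv: "U \<bullet> v = 0" using orth[of "Suc (2 * _)"] by (simp add: LIMSEQ_const_iff)
  have "norm (v \<times> w) \<ge> \<eta>"
  proof (rule LIMSEQ_le_const)
    show "(\<lambda>k. norm (e (2 * k) \<times> e (1 + 2 * k))) \<longlonglongrightarrow> norm (v \<times> w)"
      using v(1) w(1) by (intro tendsto_norm tendsto_cross3)
    show "\<exists>N. \<forall>k\<ge>N. norm (e (2 * k) \<times> e (1 + 2 * k)) \<ge> \<eta>" using e_cross by simp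
  qed
  then have "v \<times> w \<noteq> 0" using \<eta>_pos by auto
  moreover have "norm ((if even n then v else w) - e n) \<le> 2 * E n" for n
    using v(2)[of "n div 2"] w(2)[of "n div 2"] by (cases "even n") auto
  ultimately have "is_limit U v w"
    unfolding is_limit_def using unit[OF U(1)] unit[OF v(1)] unit[OF w(1)] u_norm e_norm Uv Uw U(2) by simp
  then show thesis using that by blast
qed

end

section \<open>Lower bounds for the limit form, and uniform approximation\<close>

lemma proj_dist_le_1: "proj_dist a b \<le> 1"
proof (cases "a = 0 \<or> b = 0")
  case False
  then show ?thesis using norm_cross_le[of a b] by (simp add: proj_dist_def divide_le_eq)
qed (auto simp: proj_dist_def)

lemma proj_dist_scaleR_left:
  assumes "c \<noteq> 0"
  shows "proj_dist (c *\<^sub>R a) b = proj_dist a b"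
  using assms by (simp add: proj_dist_def cross_mult_left)

context golden_tower
begin

lemma norm_x_mono: "norm (x n) \<le> norm (x (Suc n))"
  using growth[of n] norm_ge_zero[of "x n"] by linarith

lemma index_between:
  assumes "norm (x m) \<le> t"
  obtains n where "n \<ge> m" "norm (x n) \<le> t" "t < norm (x (Suc n))"
proof -
  have lin: "real n \<le> norm (x n)" for n
  proof (induction n)
    case (Suc n)
    then show ?case using growth[of n] x_ge_1[of n] by simp
  qed simp
  have "\<exists>n\<ge>m. norm (x n) \<le> t \<and> t < norm (x (Suc n))"
  proof (rule ccontr)
    assume neg: "\<not> ?thesis"
    have all: "norm (x (m + k)) \<le> t" for k
    proof (induction k)
      case (Suc k)
      then show ?case using neg by (metis add_Suc_right le_add1 not_le)
    qed (use assms in simp)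
    obtain N :: nat where "t < real N" using reals_Archimedean2 by blast
    then show False using all[of N] lin[of "m + N"] by simp
  qed
  then show thesis using that by blast
qed

lemma limit_near_direction:
  assumes "is_limit U v w"
  obtains f where "f \<in> {v, w}" "norm f = 1" "norm (f - e n) \<le> 2 * E n"
proof (cases "even n")
  case True
  then have "norm (v - e n) \<le> 2 * E n" using assms by (auto simp: is_limit_def dest!: spec[of _ n])
  then show thesis using that[of v] assms by (simp add: is_limit_def)
next
  case False
  then have "norm (w - e n) \<le> 2 * E n" using assms by (auto simp: is_limit_def dest!: spec[of _ n])
  then show thesis using that[of w] assms by (simp add: is_limit_def)
qed

text \<open>The error \<open>a \<bullet> (U - u n)\<close> is at most
  \<open>2 * norm a * \<beta> (Suc n)\<close>, which \<open>\<beta>_small\<close> with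
  \<open>X = norm a\<close> keeps within half of the bound from
  \<open>stage_lower_bound\<close>.\<close>

lemma limit_half_bound:
  assumes lim: "is_limit U v w" and a: "a \<in> int_points" "\<And>b::int. a \<noteq> of_int b *\<^sub>R x (Suc n)"
    and le: "norm a powr golden_ratio \<le> norm (x (n + 2))"
  shows "\<bar>a \<bullet> U\<bar> \<ge> \<bar>a \<bullet> u n\<bar> / 2" "\<bar>a \<bullet> U\<bar> > 0"
proof -
  obtain r N where st: "stage (x n) (x (Suc n)) (u n) (T n) r N" using stages by blast
  have "a \<noteq> 0" using a(2)[of 0] by auto
  then have A: "norm a \<ge> 1" using a(1) norm_int_point_ge_1 by blast
  define c where "c = 1 / (8 * norm (x n) * T n)"
  have c0: "c > 0" using x_ge_1[of n] T_ge_1[of n] unfolding c_def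
    by (intro divide_pos_pos mult_pos_pos) linarith+
  have lo: "\<bar>a \<bullet> u n\<bar> \<ge> c / norm a" using stage_lower_bound[OF st a] by (simp add: c_def)
  have "\<bar>a \<bullet> (U - u n)\<bar> \<le> norm a * (2 * \<beta> (Suc n))"
    using Cauchy_Schwarz_ineq2[of a "U - u n"] lim mult_left_mono[of "norm (U - u n)" "2 * \<beta> (Suc n)" "norm a"]
    by (auto simp: is_limit_def intro: order_trans)
  also have "\<dots> = 2 * (\<beta> (Suc n) * (norm a)\<^sup>2) / norm a"
    using \<open>a \<noteq> 0\<close> by (simp add: power2_eq_square)
  also have "\<dots> \<le> 2 * (c / 4) / norm a"
    using \<beta>_small[OF A le] by (intro divide_right_mono mult_left_mono) (auto simp: c_def mult.assoc)
  also have "\<dots> = c / norm a / 2" by simp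
  also have "\<dots> \<le> \<bar>a \<bullet> u n\<bar> / 2" using lo by simp
  finally have "\<bar>a \<bullet> (U - u n)\<bar> \<le> \<bar>a \<bullet> u n\<bar> / 2" .
  then show "\<bar>a \<bullet> U\<bar> \<ge> \<bar>a \<bullet> u n\<bar> / 2"
    unfolding inner_diff_right by linarith
  moreover have "c / norm a > 0" using c0 A by (intro divide_pos_pos) linarith+
  ultimately show "\<bar>a \<bullet> U\<bar> > 0" using lo by linarith
qed

lemma limit_at_x:
  assumes lim: "is_limit U v w"
  shows "\<bar>x n \<bullet> U\<bar> \<le> 2 / T n"
proof -
  \<comment> \<open>\<open>\<beta>_small\<close> is used at \<open>X = 1\<close>: its factor
    \<open>1 / norm (x n)\<close> already offsets the norm of \<open>x n\<close>.\<close>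
  have A: "(1::real) powr golden_ratio \<le> norm (x (n + 2))" using x_ge_1[of "n + 2"] by simp
  have P: "norm (x n) > 0" and T: "T n > 0" using x_ge_1[of n] T_ge_1[of n] by linarith+
  have "\<bar>x n \<bullet> (U - u n)\<bar> \<le> norm (x n) * (2 * \<beta> (Suc n))"
    using Cauchy_Schwarz_ineq2[of "x n" "U - u n"] lim mult_left_mono[of "norm (U - u n)" "2 * \<beta> (Suc n)" "norm (x n)"]
    by (auto simp: is_limit_def intro: order_trans)
  also have "\<dots> \<le> norm (x n) * (2 * (1 / (32 * norm (x n) * T n)))"
    using \<beta>_small[OF _ A] by (intro mult_left_mono) auto
  also have "\<dots> \<le> 1 / T n" using P T by (simp add: field_simps)
  finally show ?thesis using x_u[of n] by (simp add: inner_diff_right)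
qed

text \<open>The value \<open>\<bar>a \<bullet> u n\<bar>\<close> is at least \<open>1 / T n\<close>,
  and the direction of \<open>x n\<close> lies within \<open>2 * E n \<le> 8 / T n\<close> of
  \<open>v\<close> or \<open>w\<close>.\<close>

lemma lower_bound_multiple:
  fixes b :: int
  assumes lim: "is_limit U v w" and b: "b \<noteq> 0" and a: "a = of_int b *\<^sub>R x n"
    and le: "norm a powr golden_ratio \<le> norm (x (n + 2))" and s: "s \<ge> 16"
  shows "\<bar>a \<bullet> U\<bar> > 0 \<and> (\<exists>f\<in>{v, w}. proj_dist a f \<le> \<bar>a \<bullet> U\<bar> * (s * norm a powr golden_ratio))"
proof -
  have aint: "a \<in> int_points" using a x_int by (simp add: int_points_scaleR)
  have b1: "\<bar>real_of_int b\<bar> \<ge> 1" using b by linarith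
  have "a \<noteq> 0" using a b x_nz by simp
  then have A: "norm a \<ge> 1" using aint norm_int_point_ge_1 by blast
  have T: "T n > 0" and P: "norm (x n) > 0" using T_ge_1[of n] x_ge_1[of n] by linarith+
  have nz: "a \<noteq> of_int c *\<^sub>R x (Suc n)" for c :: int
  proof
    assume "a = of_int c *\<^sub>R x (Suc n)"
    then have "a \<times> x (Suc n) = 0" by (simp add: cross_mult_left)
    then have "x n \<times> x (Suc n) = 0" using a b by (simp add: cross_mult_left)
    then show False using cross_ge_1[of n] by simp
  qed
  have "\<bar>a \<bullet> u n\<bar> = \<bar>of_int b\<bar> / T n" using x_u[of n] by (simp add: a abs_mult)
  then have "\<bar>a \<bullet> u n\<bar> \<ge> 1 / T n" using b1 T by (simp add: divide_right_mono)
  then have low: "\<bar>a \<bullet> U\<bar> \<ge> 1 / (2 * T n)" and pos: "\<bar>a \<bullet> U\<bar> > 0"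
    using limit_half_bound[OF lim aint nz le] by simp_all
  obtain f where f: "f \<in> {v, w}" "norm f = 1" "norm (f - e n) \<le> 2 * E n"
    using limit_near_direction[OF lim] by blast
  have "proj_dist a f = proj_dist (x n) f" using b by (simp add: a proj_dist_scaleR_left)
  also have "\<dots> = norm (e n \<times> f)"
    using f(2) by (simp add: proj_dist_def e_def cross_mult_left divide_inverse mult.commute)
  also have "\<dots> \<le> 2 * E n"
    using norm_cross_unit_diff(1)[OF f(2), of "e n" f] f(3) by (simp add: norm_minus_commute)
  also have "\<dots> \<le> 8 / T n"
    using x_ge_1[of n] T P by (simp add: E_def field_simps)
  also have "\<dots> = (1 / (2 * T n)) * (16 * 1)" by simp
  also have "\<dots> \<le> \<bar>a \<bullet> U\<bar> * (s * norm a powr golden_ratio)"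
    using low s T ge_one_powr_ge_zero[OF A, of golden_ratio] golden_ratio_bounds by (intro mult_mono) auto
  finally show ?thesis using f(1) pos by blast
qed

text \<open>The parameter \<open>s\<close> stands for \<open>\<psi> (norm a)\<close>. Multiples of
  \<open>x n\<close> or \<open>x (n + 1)\<close> fall under \<open>lower_bound_multiple\<close>. Off
  their plane the right-hand side is at least 1, which exceeds no less than any projective distance;
  in the plane the estimates of both sides are proportional to the coefficient of
  \<open>x n\<close>.\<close>

lemma lower_bound:
  assumes lim: "is_limit U v w" and a: "a \<in> int_points" "a \<noteq> 0"
    and ge: "norm (x (Suc n)) \<le> norm a powr golden_ratio"
    and le: "norm a powr golden_ratio \<le> norm (x (n + 2))"
    and s: "s \<ge> 32 * norm (x n)" "s \<ge> 16 / \<eta> powr (golden_ratio + 1) * norm (x n)"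
  shows "\<bar>a \<bullet> U\<bar> > 0 \<and> (\<exists>f\<in>{v, w}. proj_dist a f \<le> \<bar>a \<bullet> U\<bar> * (s * norm a powr golden_ratio))"
proof -
  let ?g = golden_ratio and ?A = "norm a" and ?P = "norm (x n)" and ?Q = "norm (x (Suc n))"
  obtain r N where st: "stage (x n) (x (Suc n)) (u n) (T n) r N" using stages by blast
  have A: "?A \<ge> 1" using a norm_int_point_ge_1 by blast
  have P: "?P \<ge> 1" and Q: "?Q \<ge> 1" and T: "T n \<ge> 1" using x_ge_1 T_ge_1 by auto
  have s32: "s \<ge> 32" using s P by linarith
  show ?thesis
  proof (cases "\<exists>b::int. a = of_int b *\<^sub>R x (Suc n)")
    case True
    then obtain b :: int where b: "a = of_int b *\<^sub>R x (Suc n)" by blast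
    have "b \<noteq> 0" using b a by auto
    moreover have "?A powr ?g \<le> norm (x (Suc n + 2))" using le norm_x_mono[of "n + 2"] by simp
    ultimately show ?thesis using lower_bound_multiple[OF lim _ b, of s] s32 by simp
  next
    case False
    then have half: "\<bar>a \<bullet> U\<bar> \<ge> \<bar>a \<bullet> u n\<bar> / 2" and pos: "\<bar>a \<bullet> U\<bar> > 0"
      using limit_half_bound[OF lim a(1) _ le] by auto
    show ?thesis
    proof (cases "a \<bullet> (x n \<times> x (Suc n)) = 0")
      case offplane: False
      have "1 \<le> \<bar>a \<bullet> U\<bar> * (s * ?A powr ?g)"
        using stage_off_plane[OF st a(1) offplane]
      proof (elim disjE conjE)
        assume "\<bar>a \<bullet> u n\<bar> \<ge> 1 / (2 * ?P * ?Q)"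
        then have "\<bar>a \<bullet> U\<bar> \<ge> 1 / (4 * ?P * ?Q)" using half by simp
        then have "(1 / (4 * ?P * ?Q)) * ((32 * ?P) * ?Q) \<le> \<bar>a \<bullet> U\<bar> * (s * ?A powr ?g)"
          using s ge P Q s32 by (intro mult_mono) auto
        moreover have "(1 / (4 * ?P * ?Q)) * ((32 * ?P) * ?Q) = 8"
          using x_nz[of n] x_nz[of "Suc n"] by simp
        ultimately show ?thesis by linarith
      next
        assume 1: "\<bar>a \<bullet> u n\<bar> \<ge> 1 / (8 * ?A * ?Q)" and 2: "?A \<ge> T n / (2 * ?Q)"
        \<comment> \<open>Raising \<open>?A \<ge> ?Q powr ?g / 2\<close> to the power \<gamma> - 1
          and using \<gamma> (\<gamma> - 1) = 1 gives a bound linear in \<open>?Q\<close>.\<close>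
        have "?Q powr ?g / 2 = ?Q powr (?g + 1) / (2 * ?Q)" using Q by (simp add: powr_add)
        also have "\<dots> \<le> T n / (2 * ?Q)" using T_ge[of n] by (intro divide_right_mono) auto
        finally have "?Q powr ?g / 2 \<le> ?A" using 2 by linarith
        then have "(?Q powr ?g / 2) powr (?g - 1) \<le> ?A powr (?g - 1)"
          using golden_ratio_bounds by (intro powr_mono2) auto
        moreover have "(?Q powr ?g / 2) powr (?g - 1) = ?Q / 2 powr (?g - 1)"
          using golden_ratio_square Q by (simp add: powr_divide powr_powr algebra_simps)
        moreover have "(2::real) powr (?g - 1) \<le> 2 powr 1"
          using golden_ratio_bounds by (intro powr_mono) auto
        then have "?Q / 2 \<le> ?Q / 2 powr (?g - 1)" using Q by (intro divide_left_mono) auto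
        ultimately have q2: "?Q / 2 \<le> ?A powr (?g - 1)" by linarith
        have "?A powr ?g = ?A powr (1 + (?g - 1))" by simp
        also have "\<dots> = ?A * ?A powr (?g - 1)" using A by (subst powr_add) simp
        finally have Ag: "?A powr ?g = ?A * ?A powr (?g - 1)" .
        have "?A * (?Q / 2) \<le> ?A powr ?g" unfolding Ag using q2 A by (intro mult_left_mono) auto
        moreover have "\<bar>a \<bullet> U\<bar> \<ge> 1 / (16 * ?A * ?Q)" using 1 half by simp
        ultimately have "(1 / (16 * ?A * ?Q)) * (32 * (?A * (?Q / 2))) \<le> \<bar>a \<bullet> U\<bar> * (s * ?A powr ?g)"
          using s32 A Q by (intro mult_mono) auto
        moreover have "(1 / (16 * ?A * ?Q)) * (32 * (?A * (?Q / 2))) = 1"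
          using a(2) x_nz[of "Suc n"] by simp
        ultimately show ?thesis by linarith
      qed
      then have "proj_dist a v \<le> \<bar>a \<bullet> U\<bar> * (s * ?A powr ?g)" using proj_dist_le_1[of a v] by linarith
      then show ?thesis using pos by blast
    next
      case True
      then obtain i j :: int where ij: "a = of_int i *\<^sub>R x n + of_int j *\<^sub>R x (Suc n)"
        using int_point_in_plane[of "x n" "x (Suc n)" r a] st a by (auto simp: stage_def)
      have i0: "i \<noteq> 0" using False ij by auto
      then have i1: "\<bar>real_of_int i\<bar> \<ge> 1" by linarith
      show ?thesis
      proof (cases "j = 0")
        case True
        then show ?thesis using lower_bound_multiple[OF lim i0 _ le, of s] ij s32 by simp
      next
        case False
        then have j1: "\<bar>real_of_int j\<bar> \<ge> 1" by linarith
        have "norm (x n \<times> x (Suc n)) = norm (e n \<times> e (Suc n)) * (?P * ?Q)"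
          using x_nz[of n] x_nz[of "Suc n"] by (simp add: e_def cross_mult_left cross_mult_right field_simps)
        then have cr: "norm (x n \<times> x (Suc n)) \<ge> \<eta> * (?P * ?Q)"
          using e_cross[of n] by (simp add: mult_right_mono)
        \<comment> \<open>The cross product with \<open>x n\<close> isolates \<open>j\<close>; as
          consecutive directions stay apart by \<eta>, this forces
          \<open>?A \<ge> \<eta> * ?Q\<close>.\<close>
        have "a \<times> x n = - (of_int j *\<^sub>R (x n \<times> x (Suc n)))"
          using cross_skew[of "x (Suc n)" "x n"] by (simp add: ij cross_add_left cross_mult_left)
        then have "\<bar>of_int j\<bar> * norm (x n \<times> x (Suc n)) \<le> ?A * ?P"
          using norm_cross_le[of a "x n"] by simp
        then have "norm (x n \<times> x (Suc n)) \<le> ?A * ?P"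
          using j1 mult_right_mono[of 1 "\<bar>real_of_int j\<bar>" "norm (x n \<times> x (Suc n))"] by simp
        then have "(\<eta> * ?Q) * ?P \<le> ?A * ?P" using cr by (simp add: mult_ac)
        moreover have "?P > 0" using P by linarith
        ultimately have AQ: "\<eta> * ?Q \<le> ?A" using mult_le_cancel_right_pos by blast
        have "(\<eta> * ?Q) powr (?g + 1) \<le> ?A powr (?g + 1)"
          using AQ \<eta>_pos golden_ratio_bounds by (intro powr_mono2) auto
        then have AQg: "\<eta> powr (?g + 1) * ?Q powr (?g + 1) \<le> ?A powr (?g + 1)"
          using \<eta>_pos by (simp add: powr_mult)
        have \<eta>g: "\<eta> powr (?g + 1) > 0" using \<eta>_pos by simp
        obtain f where f: "f \<in> {v, w}" "norm f = 1" "norm (f - e (Suc n)) \<le> 2 * E (Suc n)"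
          using limit_near_direction[OF lim] by blast
        have "norm (a \<times> e (Suc n)) = \<bar>of_int i\<bar> * norm (x n \<times> e (Suc n))"
          by (simp add: ij e_def cross_add_left cross_mult_left cross_mult_right abs_mult)
        also have "\<dots> \<le> \<bar>of_int i\<bar> * ?P"
          using norm_cross_le[of "x n" "e (Suc n)"] e_norm by (intro mult_left_mono) auto
        finally have 1: "norm (a \<times> e (Suc n)) \<le> \<bar>of_int i\<bar> * ?P" .
        \<comment> \<open>Replacing \<open>e (Suc n)\<close> by its limit \<open>f\<close> costs at
          most 1, as \<open>?A \<le> norm (x (n + 2))\<close> and \<open>T (Suc n)\<close> is at
          least the square of that norm.\<close>
        have 2: "?A * norm (f - e (Suc n)) \<le> \<bar>of_int i\<bar> * ?P"
        proof -
          let ?R = "norm (x (n + 2))"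
          have R: "?R \<ge> 8" using growth[of "Suc n"] Q by simp
          have "?A powr 1 \<le> ?A powr ?g" using A golden_ratio_bounds by (intro powr_mono) auto
          then have AR: "?A \<le> ?R" using le A by simp
          have "8 * ?R \<le> T (Suc n)"
            using T_ge_square[of "Suc n"] R mult_right_mono[of 8 ?R ?R] by (simp add: power2_eq_square)
          also have "T (Suc n) \<le> T (Suc n) * ?Q" using Q T_ge_1[of "Suc n"] by simp
          finally have TR: "8 * ?R \<le> T (Suc n) * ?Q" .
          have "?A * norm (f - e (Suc n)) \<le> ?R * (8 / (T (Suc n) * ?Q))"
            using AR f(3) A by (intro mult_mono) (auto simp: E_def)
          also have "\<dots> \<le> 1" using TR R by (simp add: divide_le_eq)
          also have "\<dots> \<le> \<bar>of_int i\<bar> * ?P" using i1 P mult_mono[of 1 "\<bar>real_of_int i\<bar>" 1 ?P] by simp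
          finally show ?thesis .
        qed
        have "a \<times> f = a \<times> e (Suc n) + a \<times> (f - e (Suc n))" by (simp add: Cross3.right_diff_distrib)
        then have "norm (a \<times> f) \<le> 2 * \<bar>of_int i\<bar> * ?P"
          using norm_triangle_ineq[of "a \<times> e (Suc n)" "a \<times> (f - e (Suc n))"]
            norm_cross_le[of a "f - e (Suc n)"] 1 2 by simp
        then have pd: "proj_dist a f \<le> 2 * \<bar>of_int i\<bar> * ?P / ?A"
          using f(2) by (simp add: proj_dist_def divide_right_mono)
        have "\<bar>a \<bullet> u n\<bar> = \<bar>of_int i\<bar> / T n" using stage_in_plane[OF st, of i j] ij by simp
        also have "\<dots> \<ge> \<bar>of_int i\<bar> / (4 * ?Q powr (?g + 1))"
          using T_le[of n] T x_nz[of "Suc n"] by (intro divide_left_mono mult_pos_pos) auto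
        finally have low: "\<bar>a \<bullet> U\<bar> \<ge> \<bar>of_int i\<bar> / (8 * ?Q powr (?g + 1))" using half by simp
        \<comment> \<open>The power of \<eta> in the second hypothesis on \<open>s\<close>
          compensates for having only \<open>?A \<ge> \<eta> * ?Q\<close>.\<close>
        have "16 * ?P * ?Q powr (?g + 1) =
            (16 / \<eta> powr (?g + 1) * ?P) * (\<eta> powr (?g + 1) * ?Q powr (?g + 1))"
          using \<eta>g by simp
        also have "\<dots> \<le> s * ?A powr (?g + 1)" using s(2) AQg s32 \<eta>g by (intro mult_mono) auto
        also have "\<dots> = s * ?A powr ?g * ?A" using A by (simp add: powr_add)
        finally have key: "16 * ?P * ?Q powr (?g + 1) \<le> s * ?A powr ?g * ?A" .
        have Qg: "?Q powr (?g + 1) > 0" using x_nz[of "Suc n"] by simp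
        have A0: "?A > 0" using A by linarith
        have "16 * ?P / ?A \<le> s * ?A powr ?g / ?Q powr (?g + 1)"
          using key Qg A0 by (simp add: divide_simps mult_ac)
        then have "\<bar>of_int i\<bar> / 8 * (16 * ?P / ?A) \<le> \<bar>of_int i\<bar> / 8 * (s * ?A powr ?g / ?Q powr (?g + 1))"
          by (intro mult_left_mono) auto
        then have "2 * \<bar>of_int i\<bar> * ?P / ?A \<le> \<bar>of_int i\<bar> / (8 * ?Q powr (?g + 1)) * (s * ?A powr ?g)"
          by (simp add: mult_ac)
        also have "\<dots> \<le> \<bar>a \<bullet> U\<bar> * (s * ?A powr ?g)" using low s32 by (intro mult_right_mono) auto
        finally show ?thesis using pd pos f(1) by (meson order_trans)
      qed
    qed
  qed
qed

text \<open>The point \<open>x n\<close> with \<open>norm (x n) \<le> X < norm (x (n + 1))\<close>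
  works: its product with \<open>U\<close>, and with the perpendicular vector of matching parity, is
  at most \<open>8 / T n\<close>, and \<open>T n \<ge> X powr (golden_ratio + 1)\<close>.\<close>

lemma uniform_approximation:
  assumes lim: "is_limit U v w" and X: "X \<ge> norm (x 0)"
  shows "\<exists>a\<in>int_points. a \<noteq> 0 \<and> norm a \<le> X \<and> \<bar>a \<bullet> U\<bar> \<le> 8 / X powr (golden_ratio + 1) \<and>
    min \<bar>a \<bullet> (U \<times> v)\<bar> \<bar>a \<bullet> (U \<times> w)\<bar> \<le> 8 / X powr (golden_ratio + 1)"
proof -
  let ?g = "golden_ratio + 1"
  obtain n where n: "norm (x n) \<le> X" "X < norm (x (Suc n))" using index_between[OF X] by blast
  have X1: "X \<ge> 1" using X x_ge_1[of 0] by linarith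
  have "X powr ?g \<le> norm (x (Suc n)) powr ?g" using n X1 golden_ratio_bounds by (intro powr_mono2) auto
  then have "X powr ?g \<le> T n" using T_ge[of n] by linarith
  then have TX: "8 / T n \<le> 8 / X powr ?g" using X1 T_ge_1[of n] by (intro divide_left_mono mult_pos_pos) auto
  have "2 / T n \<le> 8 / T n" using T_ge_1[of n] by (intro divide_right_mono) auto
  then have 1: "\<bar>x n \<bullet> U\<bar> \<le> 8 / X powr ?g" using limit_at_x[OF lim, of n] TX by linarith
  obtain f where f: "f \<in> {v, w}" "norm f = 1" "norm (f - e n) \<le> 2 * E n"
    using limit_near_direction[OF lim] by blast
  have "x n = norm (x n) *\<^sub>R e n" using x_nz[of n] by (simp add: e_def)
  then have "norm (x n \<times> f) = norm (x n) * norm (e n \<times> f)" by (metis cross_mult_left norm_scaleR abs_norm_cancel)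
  also have "\<dots> \<le> norm (x n) * (2 * E n)"
    using norm_cross_unit_diff(1)[OF f(2), of "e n" f] f(3)
    by (intro mult_left_mono) (auto simp: norm_minus_commute)
  also have "\<dots> = 8 / T n" using x_nz[of n] by (simp add: E_def)
  finally have "\<bar>x n \<bullet> (U \<times> f)\<bar> \<le> 8 / X powr ?g"
    using norm_triple_le[of "x n" U f] lim TX by (simp add: is_limit_def)
  then have "min \<bar>x n \<bullet> (U \<times> v)\<bar> \<bar>x n \<bullet> (U \<times> w)\<bar> \<le> 8 / X powr ?g" using f(1) by auto
  then show ?thesis using 1 n x_int[of n] x_nz[of n] by blast
qed

end

section \<open>Existence of a sequence of stages with prescribed growth\<close>

text \<open>Dependent choice on tuples of two consecutive points, form, scale and error bound. The
  growth function \<open>B\<close> sees the norm of the preceding point, which lets \<psi> dictate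
  the growth.\<close>

lemma golden_tower_exists:
  assumes st: "stage p q u0 T0 r N" and pq: "8 * norm p \<le> norm q" "64 \<le> norm q"
  obtains x u T \<beta> where "golden_tower x u T \<beta>" "x 0 = p" "x 1 = q"
    "\<And>n. norm (x (n + 2)) \<ge> B (norm (x (Suc n)))"
proof -
  let ?P = "\<lambda>(n::nat) (p', q', u', T', b'). (\<exists>r N. stage p' q' u' T' r N) \<and> 64 \<le> norm q' \<and> b' > (0::real) \<and>
      (n = 0 \<longrightarrow> p' = p \<and> q' = q)"
  let ?Q = "\<lambda>(n::nat) (p, q, u, T, b) (p', q', u', T', b'). p' = q \<and> 8 * norm q \<le> norm q' \<and>
      B (norm q) \<le> norm q' \<and>
      norm (q' /\<^sub>R norm q' - p /\<^sub>R norm p) \<le> 4 / (T * norm p) \<and> norm (u' - u) \<le> b' \<and> b' \<le> b / 2 \<and>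
      (\<forall>X\<ge>1. X powr golden_ratio \<le> norm q' \<longrightarrow> b' * X\<^sup>2 \<le> 1 / (32 * norm p * T))"
  have "\<exists>s. \<forall>n. ?P n (s n) \<and> ?Q n (s n) (s (Suc n))"
  proof (rule dependent_nat_choice)
    \<comment> \<open>The initial error bound 1 is an arbitrary positive number.\<close>
    have "?P 0 (p, q, u0, T0, 1)" using st pq by auto
    then show "\<exists>s. ?P 0 s" by blast
  next
    fix s :: "(real ^ 3) \<times> (real ^ 3) \<times> (real ^ 3) \<times> real \<times> real" and n
    assume P: "?P n s"
    obtain p1 q1 u1 T1 b1 where s: "s = (p1, q1, u1, T1, b1)" by (metis surj_pair)
    obtain r1 N1 where st1: "stage p1 q1 u1 T1 r1 N1" using P s by auto
    have q1: "64 \<le> norm q1" and b1: "b1 > 0" using P s by auto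
    have "norm q1 \<ge> 8" using q1 by linarith
    then obtain q' u' T' r' N' b' where new: "stage q1 q' u' T' r' N'"
      "norm q' \<ge> max (8 * norm q1) (B (norm q1))"
      "norm (q' /\<^sub>R norm q' - p1 /\<^sub>R norm p1) \<le> 4 / (T1 * norm p1)"
      "norm (u' - u1) \<le> b'" "b' > 0" "b' \<le> b1 / 2"
      "\<And>X. X \<ge> 1 \<Longrightarrow> X powr golden_ratio \<le> norm q' \<Longrightarrow> b' * X\<^sup>2 \<le> 1 / (32 * norm p1 * T1)"
      using stage_step[OF st1 _ b1, of "max (8 * norm q1) (B (norm q1))"] by metis
    have "?P (Suc n) (q1, q', u', T', b') \<and> ?Q n s (q1, q', u', T', b')"
      using new q1 by (auto simp: s)
    then show "\<exists>s'. ?P (Suc n) s' \<and> ?Q n s s'" by blast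
  qed
  then obtain s where s01: "\<forall>n. ?P n (s n) \<and> ?Q n (s n) (s (Suc n))" ..
  have s: "?P n (s n)" "?Q n (s n) (s (Suc n))" for n
    using conjunct1[OF spec[OF s01, of n]] conjunct2[OF spec[OF s01, of n]] .
  define x where "x n = fst (s n)" for n
  define y where "y n = fst (snd (s n))" for n
  define u where "u n = fst (snd (snd (s n)))" for n
  define T where "T n = fst (snd (snd (snd (s n))))" for n
  define b where "b n = snd (snd (snd (snd (s n))))" for n
  have seq: "s n = (x n, y n, u n, T n, b n)" for n by (simp add: x_def y_def u_def T_def b_def)
  have Ps: "(\<exists>r N. stage (x n) (y n) (u n) (T n) r N)" "64 \<le> norm (y n)" "n = 0 \<Longrightarrow> x n = p \<and> y n = q" for n
    using s(1)[of n] by (simp_all add: seq)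
  have Qs: "x (Suc n) = y n" "8 * norm (y n) \<le> norm (y (Suc n))" "B (norm (y n)) \<le> norm (y (Suc n))"
     "norm (y (Suc n) /\<^sub>R norm (y (Suc n)) - x n /\<^sub>R norm (x n)) \<le> 4 / (T n * norm (x n))"
     "norm (u (Suc n) - u n) \<le> b (Suc n)" "b (Suc n) \<le> b n / 2"
     "X \<ge> 1 \<Longrightarrow> X powr golden_ratio \<le> norm (y (Suc n)) \<Longrightarrow> b (Suc n) * X\<^sup>2 \<le> 1 / (32 * norm (x n) * T n)" for n X
    using s(2)[of n] unfolding seq by simp_all
  have y: "y n = x (Suc n)" for n using Qs(1) by simp
  have x01: "x 0 = p" "x 1 = q" using Ps(3)[of 0] y[of 0] by simp_all
  have "golden_tower x u T b"
  proof
    show "8 * norm (x n) \<le> norm (x (Suc n))" for n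
      using x01 pq Qs(2) by (cases n) (simp_all add: y)
    show "64 \<le> norm (x 1)" using x01 pq by simp
    show "\<exists>r N. stage (x n) (x (Suc n)) (u n) (T n) r N" for n using Ps(1)[of n] by (simp add: y)
    show "norm (x (n + 2) /\<^sub>R norm (x (n + 2)) - x n /\<^sub>R norm (x n)) \<le> 4 / (T n * norm (x n))" for n
      using Qs(4)[of n] by (simp add: y)
    show "b (Suc n) * X\<^sup>2 \<le> 1 / (32 * norm (x n) * T n)"
      if "X \<ge> 1" "X powr golden_ratio \<le> norm (x (n + 2))" for n X
      using Qs(7)[of X n] that by (simp add: y)
  qed (use Qs(5,6) in auto)
  moreover have "norm (x (n + 2)) \<ge> B (norm (x (Suc n)))" for n using Qs(3)[of n] by (simp add: y)
  ultimately show thesis using that x01 by blast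
qed

section \<open>Choice of starting points and growth, and verification of the four properties\<close>

text \<open>Positivity rules out unboundedness from below, and monotonicity makes a large value
  persist.\<close>

lemma strict_mono_unbounded_eventually_ge:
  fixes \<psi> :: "real \<Rightarrow> real"
  assumes pos: "\<And>t. t > 1 \<Longrightarrow> \<psi> t > 0" and mono: "strict_mono_on {1<..} \<psi>"
    and unbounded: "\<not> bounded (\<psi> ` {1<..})"
  obtains t0 where "t0 > 1" "\<And>t. t \<ge> t0 \<Longrightarrow> \<psi> t \<ge> y"
proof -
  have "\<exists>t>1. \<psi> t \<ge> y"
  proof (rule ccontr)
    assume "\<not> ?thesis"
    then have "\<bar>\<psi> t\<bar> \<le> y" if "t > 1" for t using pos[OF that] that by force
    then have "bounded (\<psi> ` {1<..})" by (auto simp: bounded_iff)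
    then show False using unbounded by blast
  qed
  then obtain t0 where t0: "t0 > 1" "\<psi> t0 \<ge> y" by blast
  have "\<psi> t \<ge> y" if "t \<ge> t0" for t
    using strict_mono_onD[OF mono, of t0 t] t0 that by (cases "t = t0") auto
  then show thesis using that t0(1) by blast
qed

theorem theoremC:
  fixes \<psi> :: "real \<Rightarrow> real" and x0 :: "real ^ 3" and \<delta> :: real
  assumes psi_pos: "\<And>t. t > 1 \<Longrightarrow> \<psi> t > 0"
    and psi_mono: "strict_mono_on {1<..} \<psi>"
    and psi_unbounded: "\<not> bounded (\<psi> ` {1<..})"
    and x0_int: "x0 \<in> int_points" and x0_nz: "x0 \<noteq> 0"
    and delta_pos: "\<delta> > 0"
  shows "\<exists>(u :: real ^ 3) (v :: real ^ 3) (w :: real ^ 3) (C :: real) (C' :: real).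
      norm u = 1 \<and> norm v = 1 \<and> norm w = 1 \<and>
      distinct [u, v, w] \<and> independent {u, v, w} \<and>
      C > 0 \<and> C' > 0 \<and>
      coords_lin_indep_rat u \<and>
      (u \<bullet> v = 0 \<and> u \<bullet> w = 0 \<and> proj_dist x0 v \<le> \<delta> \<and> proj_dist x0 w \<le> \<delta>) \<and>
      (\<forall>X\<ge>1. \<exists>x\<in>int_points. x \<noteq> 0 \<and> norm x \<le> X \<and>
          \<bar>x \<bullet> u\<bar> \<le> C / X powr (golden_ratio + 1) \<and>
          min \<bar>x \<bullet> cross3 u v\<bar> \<bar>x \<bullet> cross3 u w\<bar> \<le> C / X powr (golden_ratio + 1)) \<and>
      (\<forall>x\<in>int_points. norm x \<ge> C' \<longrightarrow>
          \<bar>x \<bullet> u\<bar> \<ge> proj_setdist x {v, w} / (\<psi> (norm x) * norm x powr golden_ratio))"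
proof -
  let ?g = golden_ratio
  obtain d p b0 r where p: "d > 0" "x0 = d *\<^sub>R p" "p \<in> int_points" "b0 \<in> int_points" "r \<in> int_points"
    "p \<bullet> (b0 \<times> r) = 1"
    using int_point_primitive_completion[OF x0_int x0_nz] by metis
  have p0: "p \<noteq> 0" using p(2) x0_nz by auto
  have P: "norm p \<ge> 1" using p0 p(3) norm_int_point_ge_1 by blast
  \<comment> \<open>The first two entries start the sequence; the last two bring \<open>q\<close>
    and the limit directions within \<delta> of \<open>p\<close>.\<close>
  define L where "L = Max {8 * norm p, 64, 2 * norm (p \<times> b0) / \<delta>, 2 / \<delta>}"
  have L: "L \<ge> 8 * norm p" "L \<ge> 64" "L \<ge> 2 * norm (p \<times> b0) / \<delta>" "L \<ge> 2 / \<delta>"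
    unfolding L_def by (rule Max_ge; simp)+
  obtain k :: nat where k: "real k \<ge> L + norm b0" using real_arch_simple by blast
  \<comment> \<open>Adding a multiple of \<open>p\<close> keeps the determinant and turns the
    direction towards \<open>p\<close>.\<close>
  define q where "q = b0 + real k *\<^sub>R p"
  have q_int: "q \<in> int_points" unfolding q_def using p by (intro int_points_add int_points_scaleR) auto
  have det: "p \<bullet> (q \<times> r) = 1" using p(6)
    by (simp add: q_def cross_add_left cross_mult_left inner_add_right dot_cross_self)
  have "real k * norm p \<le> norm q + norm b0"
    using norm_triangle_ineq4[of q b0] by (simp add: q_def)
  moreover have "real k * 1 \<le> real k * norm p" using P by (intro mult_left_mono) auto
  ultimately have QL: "norm q \<ge> L" using k by linarith
  have pq: "8 * norm p \<le> norm q" "64 \<le> norm q" using L QL by linarith+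
  have "norm p \<le> norm q" using pq(1) P by linarith
  then obtain u0 T0 N where st: "stage p q u0 T0 r N"
    using stage_exists[OF p(3) q_int p(5) det] by metis
  \<comment> \<open>This is the future \<open>\<eta>\<close>, computed from \<open>p\<close> and
    \<open>q\<close> alone, so that the constant \<open>M\<close> may enter the growth function
    before the sequence exists.\<close>
  define \<eta>0 where "\<eta>0 = norm ((p /\<^sub>R norm p) \<times> (q /\<^sub>R norm q)) / 2"
  define M where "M = max 32 (16 / \<eta>0 powr (?g + 1))"
  have "\<exists>b. \<forall>t\<ge>b. \<psi> t \<ge> M * y" for y
    using strict_mono_unbounded_eventually_ge[OF psi_pos psi_mono psi_unbounded, of "M * y"] by blast
  then obtain B where B: "\<And>y t. t \<ge> B y \<Longrightarrow> \<psi> t \<ge> M * y" by metis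
  \<comment> \<open>The power \<open>?g\<close> fits the way \<open>norm a\<close> is located below,
    by comparing \<open>norm a powr ?g\<close> with the norms of the points.\<close>
  obtain x u T \<beta> where tower: "golden_tower x u T \<beta>" and x01: "x 0 = p" "x 1 = q"
    and xB: "\<And>n. norm (x (n + 2)) \<ge> B (norm (x (Suc n))) powr ?g"
    by (rule golden_tower_exists[OF st pq, of "\<lambda>y. B y powr ?g"]) blast
  interpret golden_tower x u T \<beta> by (rule tower)
  have \<eta>: "\<eta> = \<eta>0" using x01 by (simp add: \<eta>_def \<eta>0_def e_def)
  obtain U v w where lim: "is_limit U v w" using limit_exists by blast
  note lim' = lim[unfolded is_limit_def]
  have main: "\<bar>a \<bullet> U\<bar> > 0 \<and> (\<exists>f\<in>{v, w}. proj_dist a f \<le> \<bar>a \<bullet> U\<bar> * (\<psi> (norm a) * norm a powr ?g))"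
    if a: "a \<in> int_points" "norm a \<ge> norm (x 2)" for a
  proof -
    have A: "norm a \<ge> 1" using a(2) x_ge_1[of 2] by linarith
    have "norm a powr 1 \<le> norm a powr ?g" using A golden_ratio_bounds by (intro powr_mono) auto
    then have "norm (x 2) \<le> norm a powr ?g" using a(2) A by simp
    \<comment> \<open>With \<open>m = n + 2\<close>, \<open>lower_bound\<close> is used at index
      \<open>n + 1\<close>. Its loss of order \<open>norm (x (Suc n))\<close> is absorbed by \<psi>
      because \<open>norm (x m)\<close> was chosen beyond
      \<open>B (norm (x (Suc n))) powr ?g\<close>.\<close>
    then obtain m where m: "m \<ge> 2" "norm (x m) \<le> norm a powr ?g" "norm a powr ?g < norm (x (Suc m))"
      by (rule index_between)
    then obtain n where n: "m = n + 2" using le_Suc_ex[OF m(1)] by (metis add.commute)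
    have "B (norm (x (Suc n))) powr ?g \<le> norm a powr ?g" using xB[of n] m(2) n by simp
    then have "B (norm (x (Suc n))) \<le> norm a"
      using powr_less_mono2[of ?g "norm a" "B (norm (x (Suc n)))"] golden_ratio_bounds by fastforce
    then have s: "\<psi> (norm a) \<ge> M * norm (x (Suc n))" by (rule B)
    have "32 * norm (x (Suc n)) \<le> M * norm (x (Suc n))"
      "16 / \<eta> powr (?g + 1) * norm (x (Suc n)) \<le> M * norm (x (Suc n))"
      by (intro mult_right_mono; simp add: M_def \<eta>)+
    then show ?thesis
      using lower_bound[OF lim a(1), of "Suc n" "\<psi> (norm a)"] s m n A by fastforce
  qed
  have iv: "\<bar>a \<bullet> U\<bar> \<ge> proj_setdist a {v, w} / (\<psi> (norm a) * norm a powr ?g)"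
    if a: "a \<in> int_points" "norm a \<ge> norm (x 2)" for a
  proof -
    have A: "norm a > 1" using a(2) start growth[of 1] by (simp add: numeral_2_eq_2)
    have pos: "\<psi> (norm a) * norm a powr ?g > 0" using psi_pos[OF A] A by (intro mult_pos_pos) auto
    obtain f where f: "f \<in> {v, w}" "proj_dist a f \<le> \<bar>a \<bullet> U\<bar> * (\<psi> (norm a) * norm a powr ?g)"
      using main[OF a] by blast
    have "proj_setdist a {v, w} \<le> proj_dist a f"
      unfolding proj_setdist_def using f(1) by (intro cINF_lower) auto
    then have "proj_setdist a {v, w} \<le> \<bar>a \<bullet> U\<bar> * (\<psi> (norm a) * norm a powr ?g)" using f(2) by linarith
    then show ?thesis using pos by (simp add: pos_divide_le_eq)
  qed
  \<comment> \<open>The second entry handles \<open>X < norm (x 0)\<close>, where a coordinate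
    vector serves with the trivial bound 1.\<close>
  define C where "C = max 8 (norm (x 0) powr (?g + 1))"
  have C8: "C \<ge> 8" by (simp add: C_def)
  have iii: "\<exists>a\<in>int_points. a \<noteq> 0 \<and> norm a \<le> X \<and> \<bar>a \<bullet> U\<bar> \<le> C / X powr (?g + 1) \<and>
      min \<bar>a \<bullet> (U \<times> v)\<bar> \<bar>a \<bullet> (U \<times> w)\<bar> \<le> C / X powr (?g + 1)" if X: "X \<ge> 1" for X
  proof (cases "X \<ge> norm (x 0)")
    case True
    have "8 / X powr (?g + 1) \<le> C / X powr (?g + 1)" using C8 by (intro divide_right_mono) auto
    then show ?thesis using uniform_approximation[OF lim True] by (meson order_trans)
  next
    case False
    define a :: "real ^ 3" where "a = axis 1 1"
    have a: "a \<in> int_points" "norm a = 1"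
      by (simp add: a_def int_points_def axis_def, simp add: a_def)
    have "X powr (?g + 1) \<le> norm (x 0) powr (?g + 1)"
      using False X golden_ratio_bounds by (intro powr_mono2) auto
    then have "X powr (?g + 1) \<le> C" by (simp add: C_def)
    then have ge: "1 \<le> C / X powr (?g + 1)" using X by simp
    have "\<bar>a \<bullet> U\<bar> \<le> 1" using Cauchy_Schwarz_ineq2[of a U] a lim' by simp
    then have 1: "\<bar>a \<bullet> U\<bar> \<le> C / X powr (?g + 1)" using ge by linarith
    have "\<bar>a \<bullet> (U \<times> v)\<bar> \<le> 1"
      using norm_triple_le[of a U v] norm_cross_le[of a v] a lim' by simp
    then have "min \<bar>a \<bullet> (U \<times> v)\<bar> \<bar>a \<bullet> (U \<times> w)\<bar> \<le> C / X powr (?g + 1)" using ge by linarith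
    moreover have "a \<noteq> 0" "norm a \<le> X" using a(2) X by auto
    ultimately show ?thesis using a(1) 1 by blast
  qed
  have Q1: "norm q \<ge> 1" using pq(2) by linarith
  then have q0: "norm q > 0" by linarith
  have "2 / \<delta> \<le> norm q" "2 * norm (p \<times> b0) / \<delta> \<le> norm q" using L QL by linarith+
  then have \<delta>Q: "2 \<le> norm q * \<delta>" "2 * norm (p \<times> b0) \<le> norm q * \<delta>"
    using delta_pos by (simp_all add: pos_divide_le_eq)
  have e0: "e 0 = p /\<^sub>R norm p" "e 1 = q /\<^sub>R norm q" by (simp_all only: e_def x01)
  have pd: "proj_dist x0 f = norm (e 0 \<times> f)" if "norm f = 1" for f
  proof -
    have "proj_dist x0 f = proj_dist p f" using p(1,2) by (simp add: proj_dist_scaleR_left)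
    then show ?thesis
      using that by (simp add: proj_dist_def e0 cross_mult_left divide_inverse mult.commute)
  qed
  have E0: "2 * E 0 \<le> \<delta> / 2" "2 * E 1 \<le> \<delta> / 2"
  proof -
    have "64 * norm q \<le> T 0"
      using T_ge_square[of 0] x01 pq mult_right_mono[of 64 "norm q" "norm q"] by (simp add: power2_eq_square)
    also have "\<dots> \<le> T 0 * norm p" using P T_ge_1[of 0] mult_left_mono[of 1 "norm p" "T 0"] by simp
    finally have "8 / (T 0 * norm p) \<le> 8 / (64 * norm q)"
      using Q1 P T_ge_1[of 0] by (intro divide_left_mono mult_pos_pos) linarith+
    also have "\<dots> = (1 / 8) / norm q" by simp
    also have "\<dots> \<le> (\<delta> / 2)"
      using \<delta>Q(1) q0 by (simp add: pos_divide_le_eq mult.commute)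
    finally show 1: "2 * E 0 \<le> \<delta> / 2" by (simp add: E_def x01)
    then show "2 * E 1 \<le> \<delta> / 2" using E_half[of 0] E_pos[of 0] by simp
  qed
  have v: "norm (v - e 0) \<le> 2 * E 0" and w: "norm (w - e 1) \<le> 2 * E 1"
    using lim' by (metis even_zero, metis odd_one)
  have "proj_dist x0 v \<le> norm (v - e 0)"
    using pd[of v] lim' norm_cross_unit_diff(1)[of v "e 0" v] by (simp add: norm_minus_commute)
  then have dv: "proj_dist x0 v \<le> \<delta>" using v E0 delta_pos by linarith
  have "p \<times> q = p \<times> b0" by (simp add: q_def cross_add_right cross_mult_right)
  then have "norm (e 0 \<times> e 1) = norm (p \<times> b0) / (norm p * norm q)"
    unfolding e0 by (simp add: cross_mult_left cross_mult_right divide_inverse mult_ac)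
  also have "\<dots> \<le> norm (p \<times> b0) / (1 * norm q)"
    using P Q1 by (intro divide_left_mono mult_right_mono mult_pos_pos) auto
  also have "\<dots> \<le> \<delta> / 2" using \<delta>Q(2) q0 by (simp add: pos_divide_le_eq mult.commute)
  finally have "norm (e 0 \<times> e 1) \<le> \<delta> / 2" .
  then have dw: "proj_dist x0 w \<le> \<delta>"
    using pd[of w] lim' norm_cross_unit_diff(2)[OF e_norm[of 0], of w "e 1"] w E0 by simp
  have "U \<noteq> 0" using lim' by auto
  then have indep: "distinct [U, v, w]" "independent {U, v, w}"
    using independent_orthogonal_cross[of U v w] lim' by blast+
  \<comment> \<open>Positivity of the form on large integer points, part of \<open>main\<close>,
    gives property (i).\<close>
  have rat: "coords_lin_indep_rat U"
    using main by (intro coords_lin_indep_ratI[of "norm (x 2)"]) force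
  have pos: "C > 0" "norm (x 2) > 0" using C8 x_ge_1[of 2] by linarith+
  show ?thesis
    by (intro exI[of _ U] exI[of _ v] exI[of _ w] exI[of _ C] exI[of _ "norm (x 2)"])
      (use lim' indep rat dv dw iii iv pos in blast)
qed

end
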